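(* Let $X$ be a random element of the Hilbert sphere $\mathcal S^\infty$ whose support $\mathcal U\subset\mathcal S^\infty$ satisfies $P(X\in\mathcal U)=1$ and $\sup_{x,y\in\mathcal U}\rho(x,y)\le \pi/2$. Let $\mu$ be the intrinsic mean of $X$ and let $\hat\mu$ be the sample intrinsic mean of independent copies $X_1,\dots,X_n$ of $X$. Then, as $n\to\infty$, $\rho(\hat\mu,\mu)\to 0$ almost surely.
   Context: $\mathbb H$ is a separable infinite-dimensional real Hilbert space with inner product $\langle\cdot,\cdot\rangle$ and norm $\|\cdot\|$. The Hilbert sphere is $\mathcal S^\infty=\{f\in\mathbb H : \|f\|=1\}$, with geodesic distance $\rho(f,g)=\arccos\langle f,g\rangle$. A random element $X$ of $\mathcal S^\infty$ is a map from a complete probability space $(\Omega,\mathcal A,P)$ to $\mathcal S^\infty$, measurable with respect to the Borel $\sigma$-algebra induced by $\rho$. The intrinsic (Fréchet) mean of $X$ is the unique minimizer $\mu$ over $p\in\mathcal S^\infty$ of $M(p)=E\rho^2(X,p)$. The sample intrinsic mean $\hat\mu=\hat\mu_n$ is the unique minimizer over $p\in\mathcal S^\infty$ of $M_n(p)=n^{-1}\sum_{i=1}^n\rho^2(X_i,p)$. Under the stated condition on the support, $\mu$ exists and is unique, and almost surely so does $\hat\mu$. *)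

theory Defs
  imports "HOL-Probability.Probability"
begin

definition infinite_dimensional :: "'a::real_vector itself \<Rightarrow> bool" where
  "infinite_dimensional _ \<longleftrightarrow> \<not> (\<exists>B::'a set. finite B \<and> span B = UNIV)"

abbreviation hsphere :: "'a::real_inner set" where
  "hsphere \<equiv> sphere 0 1"

text \<open>Only meaningful on the unit sphere: outside the interval from -1 to 1, arccos is unspecified.\<close>

definition geod_dist :: "'a::real_inner \<Rightarrow> 'a \<Rightarrow> real" where
  "geod_dist f g = arccos (f \<bullet> g)"

definition geod_open :: "'a::real_inner set \<Rightarrow> bool" where
  "geod_open U \<longleftrightarrow>
     U \<subseteq> hsphere \<and> (\<forall>x\<in>U. \<exists>e>0. \<forall>y\<in>hsphere. geod_dist x y < e \<longrightarrow> y \<in> U)"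

definition hsphere_borel :: "'a::real_inner measure" where
  "hsphere_borel = sigma hsphere {U. geod_open U}"

text \<open>The topological support of the law of \<open>X\<close>.\<close>

definition rv_support :: "'w measure \<Rightarrow> ('w \<Rightarrow> 'a::real_inner) \<Rightarrow> 'a set" where
  "rv_support M X =
     {x \<in> hsphere. \<forall>V. geod_open V \<and> x \<in> V \<longrightarrow> measure M {\<omega> \<in> space M. X \<omega> \<in> V} > 0}"

definition frechet_fun :: "'w measure \<Rightarrow> ('w \<Rightarrow> 'a::real_inner) \<Rightarrow> 'a \<Rightarrow> real" where
  "frechet_fun M X p = prob_space.expectation M (\<lambda>\<omega>. (geod_dist (X \<omega>) p)\<^sup>2)"

definition sample_frechet_fun :: "nat \<Rightarrow> (nat \<Rightarrow> 'a::real_inner) \<Rightarrow> 'a \<Rightarrow> real" where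
  "sample_frechet_fun n x p = (1 / real n) * (\<Sum>i=1..n. (geod_dist (x i) p)\<^sup>2)"

text \<open>
  Both means are the unique minimizer over the sphere and are unspecified when the minimizer fails
  to exist or to be unique.
\<close>

definition intrinsic_mean :: "'w measure \<Rightarrow> ('w \<Rightarrow> 'a::real_inner) \<Rightarrow> 'a" where
  "intrinsic_mean M X = (THE p. is_arg_min (frechet_fun M X) (\<lambda>p. p \<in> hsphere) p)"

definition sample_intrinsic_mean :: "nat \<Rightarrow> (nat \<Rightarrow> 'a::real_inner) \<Rightarrow> 'a" where
  "sample_intrinsic_mean n x = (THE p. is_arg_min (sample_frechet_fun n x) (\<lambda>p. p \<in> hsphere) p)"

lemma abs_inner_hsphere_le: "x \<in> hsphere \<Longrightarrow> y \<in> hsphere \<Longrightarrow> \<bar>x \<bullet> y\<bar> \<le> 1"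
  using Cauchy_Schwarz_ineq2[of x y] by simp

text \<open>The topology of the geodesic distance is the subspace topology of the norm.\<close>

lemma geod_open_iff:
  fixes U :: "'a::real_inner set"
  shows "geod_open U \<longleftrightarrow> openin (top_of_set hsphere) U"
proof
  assume U: "geod_open U"
  show "openin (top_of_set hsphere) U"
  proof (subst openin_subopen, intro ballI)
    fix x assume x: "x \<in> U"
    then obtain e where e: "e > 0" "\<forall>y\<in>hsphere. geod_dist x y < e \<longrightarrow> y \<in> U" and xS: "x \<in> hsphere"
      using U unfolding geod_open_def by blast
    have "continuous_on hsphere (\<lambda>y. geod_dist x y)"
      unfolding geod_dist_def using abs_inner_hsphere_le[OF xS]
      by (intro continuous_intros) (auto simp: abs_le_iff)
    then have "openin (top_of_set hsphere) (hsphere \<inter> (\<lambda>y. geod_dist x y) -` {..<e})"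
      by (rule continuous_openin_preimage_gen) simp
    moreover have "geod_dist x x = 0"
      using xS by (simp add: geod_dist_def dot_square_norm)
    ultimately show "\<exists>T. openin (top_of_set hsphere) T \<and> x \<in> T \<and> T \<subseteq> U"
      using e xS by (intro exI[of _ "hsphere \<inter> (\<lambda>y. geod_dist x y) -` {..<e}"]) auto
  qed
next
  assume U: "openin (top_of_set hsphere) U"
  show "geod_open U" unfolding geod_open_def
  proof (intro conjI ballI)
    show "U \<subseteq> hsphere" using U by (rule openin_imp_subset)
    fix x assume x: "x \<in> U"
    then have xS: "x \<in> hsphere" using \<open>U \<subseteq> hsphere\<close> by blast
    obtain d where d: "d > 0" "\<And>y. y \<in> hsphere \<Longrightarrow> dist y x < d \<Longrightarrow> y \<in> U"
      using U x by (auto simp: openin_euclidean_subtopology_iff)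
    define s where "s = max (-1) (1 - d\<^sup>2 / 2)"
    have s: "-1 \<le> s" "s < 1" using d(1) by (auto simp: s_def)
    have "arccos s > 0"
      using arccos_less_mono[of 1 s] s by simp
    moreover have "y \<in> U" if y: "y \<in> hsphere" "geod_dist x y < arccos s" for y
    proof -
      have "x \<bullet> y > s"
        using y(2) arccos_less_mono[of "x \<bullet> y" s] abs_inner_hsphere_le[OF xS y(1)] s
        by (simp add: geod_dist_def abs_le_iff)
      then have "2 - 2 * (x \<bullet> y) < d\<^sup>2" by (simp add: s_def)
      moreover have "(dist y x)\<^sup>2 = 2 - 2 * (x \<bullet> y)"
        using xS y(1) dot_norm_neg[of x y]
        by (simp add: dist_norm norm_minus_commute field_simps)
      ultimately have "dist y x < d"
        using d(1) by (metis less_eq_real_def power2_less_imp_less)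
      then show ?thesis using d(2) y(1) by blast
    qed
    ultimately show "\<exists>e>0. \<forall>y\<in>hsphere. geod_dist x y < e \<longrightarrow> y \<in> U" by blast
  qed
qed

lemma space_hsphere_borel [simp]: "space hsphere_borel = hsphere"
  unfolding hsphere_borel_def by (rule space_measure_of) (force simp: geod_open_def)

lemma sets_hsphere_borel:
  "sets (hsphere_borel :: 'a::real_inner measure) = sets (restrict_space borel hsphere)"
proof -
  have eq: "{U. geod_open U} = (\<inter>) hsphere ` {S :: 'a set. open S}"
    by (auto simp: geod_open_iff openin_open)
  have borel_sets: "sets borel = sigma_sets UNIV {S :: 'a set. open S}"
    by (simp add: borel_def)
  have "(hsphere :: 'a set) \<in> sets borel"
    unfolding sphere_def by (intro borel_closed closed_Collect_eq continuous_intros)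
  then have "(\<inter>) hsphere ` sets borel = sigma_sets hsphere ((\<inter>) hsphere ` {S :: 'a set. open S})"
    unfolding borel_sets by (intro sigma_sets_Int) simp_all
  then have "sets (restrict_space borel hsphere) = sigma_sets hsphere ((\<inter>) hsphere ` {S :: 'a set. open S})"
    by (simp add: sets_restrict_space)
  then show ?thesis
    unfolding hsphere_borel_def eq by (simp add: sets_measure_of image_subset_iff)
qed

end

theory Submission
  imports Defs
begin

text \<open>
  Write \<open>F p = E arccos\<^sup>2 \<langle>X, p\<rangle>\<close>. Since the diameter of the support \<open>U\<close> is at most \<open>\<pi>/2\<close>, the vectors
  of \<open>U\<close> have pairwise nonnegative inner products, so the closed convex cone \<open>K\<close> generated by \<open>U\<close> (its
  bidual cone) lies in the dual cone of \<open>U\<close>. The function \<open>arccos\<^sup>2\<close> is convex on \<open>[-1, 1]\<close> with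
  derivative at most \<open>-2\<close>; normalizing the midpoint of \<open>p, q \<in> K\<close> therefore gives
  \<open>F (sgn (p + q)) \<le> (F p + F q) / 2 - c (1 - \<langle>p, q\<rangle>) / 2\<close> with \<open>c > 0\<close> depending only on a lower bound
  for \<open>E \<langle>X, p\<rangle>\<close> and \<open>E \<langle>X, q\<rangle>\<close>. Hence minimizing sequences in \<open>K\<close> are Cauchy, which replaces compactness;
  projecting to \<open>K\<close> shows that the minimizer over \<open>K\<close> is a global one, and \<open>F p - F \<mu>\<close> controls
  \<open>1 - \<langle>p, \<mu>\<rangle>\<close>. All this applies to the empirical distribution as well, so \<open>\<mu>\<^sub>n\<close> exists and
  lies in \<open>K\<close>. Finally \<open>F\<^sub>n \<rightarrow> F\<close> uniformly on the sphere almost surely, because the functions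
  \<open>x \<mapsto> arccos\<^sup>2 \<langle>x, p\<rangle>\<close> are uniformly bounded and uniformly equicontinuous and the space is separable.
\<close>

section \<open>The squared arccosine\<close>

abbreviation sq_arccos :: "real \<Rightarrow> real" where
  "sq_arccos s \<equiv> (arccos s)\<^sup>2"

lemma continuous_on_sq_arccos: "continuous_on {-1..1} sq_arccos"
  by (intro continuous_intros) auto

lemma sq_arccos_le_pi_sq: "-1 \<le> s \<Longrightarrow> s \<le> 1 \<Longrightarrow> sq_arccos s \<le> pi\<^sup>2"
  using arccos_bounded[of s] by (intro power_mono) auto

lemma DERIV_sq_arccos:
  assumes "-1 < s" "s < 1"
  shows "(sq_arccos has_real_derivative - 2 * (arccos s / sin (arccos s))) (at s)"
  using assms sin_arccos_nonzero[of s]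
  by (auto intro!: derivative_eq_intros simp: sin_arccos field_simps)

text \<open>The derivative is \<open>(sin x - x * cos x) / (sin x)\<^sup>2\<close>, whose numerator
  vanishes at 0 and has derivative \<open>x * sin x\<close>, nonnegative up to
  \<open>pi\<close>.\<close>

lemma div_sin_mono:
  fixes r u :: real
  assumes "0 < r" "r \<le> u" "u < pi"
  shows "r / sin r \<le> u / sin u"
proof (rule DERIV_nonneg_imp_nondecreasing[OF assms(2), where f = "\<lambda>x. x / sin x"])
  fix x assume x: "r \<le> x" "x \<le> u"
  then have s: "sin x > 0" using assms by (intro sin_gt_zero) auto
  have "sin 0 - 0 * cos 0 \<le> sin x - x * cos x"
  proof (rule DERIV_nonneg_imp_nondecreasing[where f = "\<lambda>x. sin x - x * cos x"])
    show "0 \<le> x" using x assms by auto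
    fix y assume y: "0 \<le> y" "y \<le> x"
    have "((\<lambda>x. sin x - x * cos x) has_real_derivative y * sin y) (at y)"
      by (auto intro!: derivative_eq_intros)
    moreover have "0 \<le> y * sin y"
      using y x assms by (intro mult_nonneg_nonneg sin_ge_zero) auto
    ultimately show "\<exists>z. ((\<lambda>x. sin x - x * cos x) has_real_derivative z) (at y) \<and> 0 \<le> z"
      by blast
  qed
  then have "0 \<le> (sin x - x * cos x) / (sin x)\<^sup>2" by simp
  moreover have "((\<lambda>x. x / sin x) has_real_derivative (sin x - x * cos x) / (sin x)\<^sup>2) (at x)"
    using s by (auto intro!: derivative_eq_intros simp: power2_eq_square)
  ultimately show "\<exists>y. ((\<lambda>x. x / sin x) has_real_derivative y) (at x) \<and> 0 \<le> y" by blast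
qed

text \<open>With \<open>r = arccos s\<close> the derivative is \<open>- 2 * (r / sin r)\<close>, and
  \<open>r\<close> decreases in \<open>s\<close>. It diverges at -1, and its formula is 0/0 at 1,
  hence the open interval.\<close>

lemma convex_on_sq_arccos: "convex_on {-1<..<1} sq_arccos"
proof (rule convex_on_realI)
  show "(sq_arccos has_real_derivative - 2 * (arccos s / sin (arccos s))) (at s)"
    if "s \<in> {-1<..<1}" for s
    using that by (intro DERIV_sq_arccos) auto
  fix s t :: real assume st: "s \<in> {-1<..<1}" "t \<in> {-1<..<1}" "s \<le> t"
  then have "arccos t / sin (arccos t) \<le> arccos s / sin (arccos s)"
    using arccos_lt_bounded[of s] arccos_lt_bounded[of t]
    by (intro div_sin_mono arccos_le_arccos) auto
  then show "- 2 * (arccos s / sin (arccos s)) \<le> - 2 * (arccos t / sin (arccos t))" by simp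
qed simp

lemma sq_arccos_midpoint:
  assumes s: "-1 \<le> s" "s \<le> 1" and t: "-1 \<le> t" "t \<le> 1"
  shows "sq_arccos ((s + t) / 2) \<le> (sq_arccos s + sq_arccos t) / 2"
proof -
  \<comment> \<open>Factors in [0, 1) tending to 1 move both points into the open interval of
    convexity and commute with midpoints; continuity then reaches the endpoints.\<close>
  define c where "c k = 1 - inverse (real (Suc k))" for k
  have c: "0 \<le> c k" "c k < 1" for k by (auto simp: c_def field_simps)
  have lim: "c \<longlonglongrightarrow> 1"
    unfolding c_def using tendsto_diff[OF tendsto_const LIMSEQ_inverse_real_of_nat] by force
  have cs: "\<bar>c k * v\<bar> < 1" if "\<bar>v\<bar> \<le> 1" for k v
  proof -
    have "\<bar>c k\<bar> * \<bar>v\<bar> \<le> \<bar>c k\<bar> * 1" using that by (intro mult_left_mono) auto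
    then show ?thesis using c[of k] by (simp add: abs_mult)
  qed
  have lim': "(\<lambda>k. sq_arccos (c k * v)) \<longlonglongrightarrow> sq_arccos v" if "\<bar>v\<bar> \<le> 1" for v
  proof (rule continuous_on_tendsto_compose[OF continuous_on_sq_arccos])
    show "(\<lambda>k. c k * v) \<longlonglongrightarrow> v" using tendsto_mult[OF lim tendsto_const, of v] by simp
    show "\<forall>\<^sub>F k in sequentially. c k * v \<in> {-1..1}"
      using cs[OF that] by (intro always_eventually) (simp add: abs_less_iff less_imp_le minus_le_iff)
  qed (use that in auto)
  have "sq_arccos (c k * ((s + t) / 2)) \<le> (sq_arccos (c k * s) + sq_arccos (c k * t)) / 2" for k
    using convex_onD[OF convex_on_sq_arccos, of "1/2" "c k * s" "c k * t"] cs[of s k] cs[of t k] s t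
    by (simp add: abs_less_iff abs_le_iff add_divide_distrib distrib_left)
  moreover have "(\<lambda>k. (sq_arccos (c k * s) + sq_arccos (c k * t)) / 2)
      \<longlonglongrightarrow> (sq_arccos s + sq_arccos t) / 2"
    using s t by (intro tendsto_intros lim') auto
  ultimately show ?thesis
    using s t by (intro LIMSEQ_le[OF lim'[of "(s + t) / 2"]]) (auto simp: abs_le_iff)
qed

text \<open>A convex function lies above its tangent, which at 0 has slope \<open>- pi\<close>. The
  endpoint 1 is outside the open interval of convexity and reduces to
  \<open>pi \<le> 4\<close>.\<close>

lemma sq_arccos_ge_tangent_0:
  assumes "-1 < s" "s \<le> 1"
  shows "sq_arccos s \<ge> (pi / 2)\<^sup>2 - pi * s"
proof (cases "s = 1")
  case True
  have "pi * pi \<le> 4 * pi" using pi_less_4 by (intro mult_right_mono) auto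
  then show ?thesis using True by (simp add: power2_eq_square)
next
  case False
  have "(sq_arccos has_real_derivative - pi) (at 0 within {-1<..<1})"
    using DERIV_sq_arccos[of 0] by (auto intro: has_field_derivative_at_within)
  from convex_on_imp_above_tangent[OF convex_on_sq_arccos _ _ _ this, of s]
  show ?thesis using assms False by (simp add: power2_eq_square interior_open)
qed

text \<open>Since \<open>sin r \<le> r\<close>, the derivative \<open>- 2 * (r / sin r)\<close> is
  at most -2; continuity includes the endpoints.\<close>

lemma sq_arccos_diff_le:
  assumes "-1 \<le> s" "s \<le> t" "t \<le> 1"
  shows "sq_arccos t \<le> sq_arccos s - 2 * (t - s)"
proof -
  have "sq_arccos t + 2 * t \<le> sq_arccos s + 2 * s"
  proof (rule DERIV_nonpos_imp_decreasing_open[OF assms(2)])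
    fix x assume x: "s < x" "x < t"
    define r where "r = arccos x"
    have r: "0 < r" "r < pi" using arccos_lt_bounded[of x] x assms by (auto simp: r_def)
    then have "sin r > 0" by (rule sin_gt_zero)
    then have "1 \<le> r / sin r" using sin_x_le_x[of r] r by simp
    moreover have "((\<lambda>s. sq_arccos s + 2 * s) has_real_derivative - 2 * (r / sin r) + 2) (at x)"
      unfolding r_def using x assms
      by (intro DERIV_add DERIV_sq_arccos DERIV_cmult_Id) auto
    ultimately show "\<exists>y. ((\<lambda>s. sq_arccos s + 2 * s) has_real_derivative y) (at x) \<and> y \<le> 0"
      by (intro exI conjI) auto
  next
    show "continuous_on {s..t} (\<lambda>s. sq_arccos s + 2 * s)"
      using assms by (intro continuous_intros) auto
  qed
  then show ?thesis by simp
qed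

lemma sq_arccos_uniformly_continuous:
  assumes "0 < e"
  obtains d where "0 < d" "\<And>s t. s \<in> {-1..1} \<Longrightarrow> t \<in> {-1..1} \<Longrightarrow> \<bar>s - t\<bar> < d \<Longrightarrow>
    \<bar>sq_arccos s - sq_arccos t\<bar> < e"
  using compact_uniformly_continuous[OF continuous_on_sq_arccos] assms
  unfolding uniformly_continuous_on_def dist_real_def by (metis compact_Icc)

text \<open>Clipping gives a bounded continuous function on the whole space, whereas
  \<open>arccos\<close> is unspecified off [-1, 1]. Measurability and the uniform law then need no
  restriction to the sphere.\<close>

definition clipped_sq_arccos :: "'a::real_inner \<Rightarrow> 'a \<Rightarrow> real" where
  "clipped_sq_arccos p x = sq_arccos (max (-1) (min 1 (x \<bullet> p)))"

lemma clipped_sq_arccos_eq: "\<bar>x \<bullet> p\<bar> \<le> 1 \<Longrightarrow> clipped_sq_arccos p x = sq_arccos (x \<bullet> p)"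
  by (simp add: clipped_sq_arccos_def abs_le_iff)

lemma clipped_sq_arccos_le: "\<bar>clipped_sq_arccos p x\<bar> \<le> pi\<^sup>2"
  unfolding clipped_sq_arccos_def using sq_arccos_le_pi_sq by simp

text \<open>For \<open>p\<close> in the unit ball, the inner product with \<open>p\<close> and the
  clipping are both 1-Lipschitz, so one modulus of uniform continuity of \<open>sq_arccos\<close> on
  [-1, 1] serves all \<open>p\<close>.\<close>

lemma clipped_sq_arccos_equicontinuous:
  assumes "0 < e"
  shows "\<exists>d>0. \<forall>p\<in>cball 0 1. \<forall>x y. dist x y < d \<longrightarrow>
    \<bar>clipped_sq_arccos p x - clipped_sq_arccos p y\<bar> < e"
proof -
  let ?c = "\<lambda>s::real. max (-1) (min 1 s)"
  obtain d where d: "0 < d" "\<And>s t. s \<in> {-1..1} \<Longrightarrow> t \<in> {-1..1} \<Longrightarrow> \<bar>s - t\<bar> < d \<Longrightarrow>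
    \<bar>sq_arccos s - sq_arccos t\<bar> < e"
    using sq_arccos_uniformly_continuous[OF assms] by metis
  have "\<bar>clipped_sq_arccos p x - clipped_sq_arccos p y\<bar> < e"
    if p: "p \<in> cball 0 1" and xy: "dist x y < d" for p x y :: 'a
  proof -
    have "\<bar>x \<bullet> p - y \<bullet> p\<bar> \<le> norm (x - y) * norm p"
      unfolding inner_diff_left[symmetric] by (rule Cauchy_Schwarz_ineq2)
    also have "\<dots> \<le> norm (x - y) * 1" using p by (intro mult_left_mono) auto
    also have "\<dots> < d" using xy by (simp add: dist_norm)
    finally have "\<bar>?c (x \<bullet> p) - ?c (y \<bullet> p)\<bar> < d" by linarith
    then show ?thesis unfolding clipped_sq_arccos_def by (intro d(2)) auto
  qed
  then show ?thesis using d(1) by blast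
qed

lemma continuous_on_clipped_sq_arccos: "continuous_on UNIV (clipped_sq_arccos p)"
proof -
  have "continuous_on UNIV (\<lambda>x. max (-1) (min 1 (x \<bullet> p)))" by (intro continuous_intros)
  from continuous_on_compose2[OF continuous_on_sq_arccos this] show ?thesis
    unfolding clipped_sq_arccos_def by fastforce
qed

lemma clipped_sq_arccos_commute: "clipped_sq_arccos p x = clipped_sq_arccos x p"
  by (simp add: clipped_sq_arccos_def inner_commute)

section \<open>Minimizers and cones in Hilbert space\<close>

text \<open>Completeness stands in for compactness: \<open>close\<close> makes a minimizing sequence
  Cauchy, and continuity passes to its limit.\<close>

lemma exists_minimizer:
  fixes f :: "'a::complete_space \<Rightarrow> real"
  assumes A: "closed A" "A \<noteq> {}" and f: "continuous_on A f" and bdd: "bdd_below (f ` A)"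
    and close: "\<And>e. e > 0 \<Longrightarrow> \<exists>d>0. \<forall>x\<in>A. \<forall>y\<in>A.
      f x < Inf (f ` A) + d \<longrightarrow> f y < Inf (f ` A) + d \<longrightarrow> dist x y < e"
  shows "\<exists>x\<in>A. \<forall>y\<in>A. f x \<le> f y"
proof -
  define I where "I = Inf (f ` A)"
  have ge: "I \<le> f y" if "y \<in> A" for y
    unfolding I_def using bdd that by (intro cInf_lower) auto
  have "\<exists>x\<in>A. f x < I + inverse (real (Suc k))" for k
    using cInf_lessD[of "f ` A" "I + inverse (real (Suc k))"] A by (auto simp: I_def)
  then obtain x where xA: "\<And>k. x k \<in> A" and x: "\<And>k. f (x k) < I + inverse (real (Suc k))"
    by metis
  have small: "\<exists>N. \<forall>k\<ge>N. f (x k) < I + d" if "d > 0" for d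
  proof -
    obtain N where N: "inverse (real (Suc N)) < d" using reals_Archimedean \<open>d > 0\<close> by blast
    have "f (x k) < I + d" if "k \<ge> N" for k
    proof -
      have "inverse (real (Suc k)) \<le> inverse (real (Suc N))"
        using that by (intro le_imp_inverse_le) auto
      then show ?thesis using x[of k] N by linarith
    qed
    then show ?thesis by blast
  qed
  have "Cauchy x"
  proof (rule metric_CauchyI)
    fix e :: real assume "e > 0"
    then obtain d where d: "d > 0" "\<forall>x\<in>A. \<forall>y\<in>A. f x < I + d \<longrightarrow> f y < I + d \<longrightarrow> dist x y < e"
      using close unfolding I_def by blast
    then show "\<exists>N. \<forall>m\<ge>N. \<forall>n\<ge>N. dist (x m) (x n) < e"
      using small[OF d(1)] xA by blast
  qed
  then obtain l where l: "x \<longlonglongrightarrow> l" using Cauchy_convergent convergent_def by blast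
  then have lA: "l \<in> A" using A(1) xA closed_sequentially by blast
  have "(\<lambda>k. f (x k)) \<longlonglongrightarrow> f l"
    using continuous_on_tendsto_compose[OF f l lA] xA by auto
  moreover have "(\<lambda>k. I + inverse (real (Suc k))) \<longlonglongrightarrow> I + 0"
    by (intro tendsto_add tendsto_const LIMSEQ_inverse_real_of_nat)
  ultimately have "f l \<le> I + 0"
    by (rule LIMSEQ_le) (use x less_imp_le in blast)
  then have "f l \<le> f y" if "y \<in> A" for y using ge[OF that] by simp
  then show ?thesis using lA by blast
qed

text \<open>The witness is the point of \<open>K\<close> nearest to \<open>p\<close>. The
  parallelogram identity gives its existence; the first variation of the distance gives the sign
  conditions.\<close>

lemma convex_cone_projection:
  fixes K :: "'a::{real_inner,complete_space} set"
  assumes K: "closed K" "0 \<in> K" and add: "\<And>x y. x \<in> K \<Longrightarrow> y \<in> K \<Longrightarrow> x + y \<in> K"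
    and scale: "\<And>c x. 0 \<le> c \<Longrightarrow> x \<in> K \<Longrightarrow> c *\<^sub>R x \<in> K"
  obtains q where "q \<in> K" "(p - q) \<bullet> q = 0" "\<And>k. k \<in> K \<Longrightarrow> (p - q) \<bullet> k \<le> 0"
proof -
  let ?f = "\<lambda>k. (norm (p - k))\<^sup>2"
  have bdd: "bdd_below (?f ` K)" by (intro bdd_belowI[of _ 0]) auto
  have "\<exists>x\<in>K. \<forall>y\<in>K. ?f x \<le> ?f y"
  proof (rule exists_minimizer)
    fix e :: real assume e: "e > 0"
    \<comment> \<open>Midpoints remain in \<open>K\<close>, so the squared distance of two
      near-minimizers is less than four times this tolerance.\<close>
    let ?d = "e\<^sup>2 / 4"
    have "dist x y < e"
      if xy: "x \<in> K" "y \<in> K" "?f x < Inf (?f ` K) + ?d" "?f y < Inf (?f ` K) + ?d" for x y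
    proof -
      have "(1/2) *\<^sub>R (x + y) \<in> K" using xy add scale by simp
      then have "Inf (?f ` K) \<le> ?f ((1/2) *\<^sub>R (x + y))"
        by (intro cInf_lower[OF _ bdd]) auto
      moreover have "(dist x y)\<^sup>2 = 2 * ?f x + 2 * ?f y - 4 * ?f ((1/2) *\<^sub>R (x + y))"
        unfolding dist_norm power2_norm_eq_inner
        by (simp add: inner_diff_left inner_diff_right inner_add_left inner_add_right inner_commute
          field_simps)
      ultimately have "(dist x y)\<^sup>2 < e\<^sup>2" using xy by argo
      then show ?thesis using e by (simp add: power2_less_imp_less)
    qed
    then show "\<exists>d>0. \<forall>x\<in>K. \<forall>y\<in>K. ?f x < Inf (?f ` K) + d \<longrightarrow> ?f y < Inf (?f ` K) + d
        \<longrightarrow> dist x y < e"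
      using e by (intro exI[of _ ?d]) auto
  qed (use K bdd in \<open>auto intro!: continuous_intros\<close>)
  then obtain q where q: "q \<in> K" and min: "\<And>k. k \<in> K \<Longrightarrow> ?f q \<le> ?f k" by blast
  have nonneg: "2 * t * ((p - q) \<bullet> k) \<le> t\<^sup>2 * (k \<bullet> k)" if "q + t *\<^sub>R k \<in> K" for t k
  proof -
    have "?f (q + t *\<^sub>R k) = ?f q - 2 * t * ((p - q) \<bullet> k) + t\<^sup>2 * (k \<bullet> k)"
      unfolding power2_norm_eq_inner
      by (simp add: inner_diff_left inner_diff_right inner_add_left inner_add_right inner_commute
          algebra_simps power2_eq_square)
    then show ?thesis using min[OF that] by linarith
  qed
  have le: "(p - q) \<bullet> k \<le> 0" if "\<And>t. 0 < t \<Longrightarrow> t \<le> 1 \<Longrightarrow> q + t *\<^sub>R k \<in> K" for k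
  proof (rule ccontr)
    let ?a = "(p - q) \<bullet> k"
    assume "\<not> ?a \<le> 0"
    then have a: "?a > 0" by simp
    \<comment> \<open>This step length yields \<open>t * (k \<bullet> k) \<le> ?a\<close>, while
      minimality demands \<open>2 * ?a \<le> t * (k \<bullet> k)\<close>. Adding 1 keeps the
      denominator positive.\<close>
    define t where "t = min 1 (?a / (k \<bullet> k + 1))"
    have kk: "k \<bullet> k \<ge> 0" by simp
    have t: "0 < t" "t \<le> 1" using a kk by (auto simp: t_def intro!: divide_pos_pos add_nonneg_pos)
    have "t \<le> ?a / (k \<bullet> k + 1)" by (simp add: t_def)
    then have "t * (k \<bullet> k + 1) \<le> ?a"
      using kk by (subst (asm) pos_le_divide_eq) (auto intro: add_nonneg_pos)
    moreover have "t * (2 * ?a) \<le> t * (t * (k \<bullet> k))"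
      using nonneg[OF that[OF t]] by (simp add: power2_eq_square mult_ac)
    then have "2 * ?a \<le> t * (k \<bullet> k)" using t by simp
    ultimately show False using a t by (simp add: distrib_left)
  qed
  have "(p - q) \<bullet> k \<le> 0" if "k \<in> K" for k
    by (rule le) (use q that add scale in auto)
  \<comment> \<open>Moving from \<open>q\<close> towards the origin also stays in \<open>K\<close>;
    together with the direction \<open>q\<close> this gives orthogonality.\<close>
  moreover have "(p - q) \<bullet> (- q) \<le> 0"
  proof (rule le)
    fix t :: real assume "0 < t" "t \<le> 1"
    then have "(1 - t) *\<^sub>R q \<in> K" using q scale by simp
    then show "q + t *\<^sub>R (- q) \<in> K" by (simp add: algebra_simps)
  qed
  ultimately show ?thesis using that[OF q] q by force
qed

text \<open>An intersection of closed half-spaces, hence closed and convex. Taken twice, it gives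
  the closed convex cone generated by \<open>U\<close> without constructing a hull.\<close>

definition dual_cone :: "'a::real_inner set \<Rightarrow> 'a set" where
  "dual_cone U = {y. \<forall>x\<in>U. 0 \<le> x \<bullet> y}"

lemma closed_dual_cone: "closed (dual_cone U)"
proof -
  have "dual_cone U = (\<Inter>x\<in>U. {y. 0 \<le> x \<bullet> y})" by (auto simp: dual_cone_def)
  then show ?thesis by (auto intro!: closed_INT closed_Collect_le continuous_intros)
qed

lemma dual_cone_add: "x \<in> dual_cone U \<Longrightarrow> y \<in> dual_cone U \<Longrightarrow> x + y \<in> dual_cone U"
  by (simp add: dual_cone_def inner_add_right)

lemma dual_cone_scale: "0 \<le> c \<Longrightarrow> x \<in> dual_cone U \<Longrightarrow> c *\<^sub>R x \<in> dual_cone U"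
  by (simp add: dual_cone_def)

lemma zero_in_dual_cone: "0 \<in> dual_cone U"
  by (simp add: dual_cone_def)

lemma sgn_in_dual_cone: "x \<in> dual_cone U \<Longrightarrow> sgn x \<in> dual_cone U"
  by (simp add: sgn_div_norm dual_cone_scale)

lemma dual_cone_antimono: "U \<subseteq> V \<Longrightarrow> dual_cone V \<subseteq> dual_cone U"
  by (auto simp: dual_cone_def)

lemma subset_bidual_cone: "U \<subseteq> dual_cone (dual_cone U)"
  by (auto simp: dual_cone_def inner_commute)

lemma closed_hsphere: "closed (hsphere :: 'a::real_inner set)"
proof -
  have "hsphere = {x :: 'a. norm x = 1}" by auto
  then show ?thesis by (auto intro!: closed_Collect_eq continuous_intros)
qed

lemma sphere_dist_sq:
  fixes p q :: "'a::real_inner"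
  assumes "p \<in> hsphere" "q \<in> hsphere"
  shows "(dist p q)\<^sup>2 = 2 * (1 - p \<bullet> q)"
proof -
  have "p \<bullet> p = 1" "q \<bullet> q = 1" using assms by (auto simp: dot_square_norm)
  then show ?thesis
    unfolding dist_norm power2_norm_eq_inner
    by (simp add: inner_diff_left inner_diff_right inner_commute)
qed

section \<open>Strong laws for bounded observations\<close>

text \<open>Hoeffding's inequality bounds the deviation probabilities by a geometric sequence, so
  Borel-Cantelli applies for each tolerance; countably many tolerances suffice.\<close>

lemma (in prob_space) strong_law_bounded:
  fixes Y :: "nat \<Rightarrow> 'a \<Rightarrow> real" and Z :: "'a \<Rightarrow> real"
  assumes indep: "indep_vars (\<lambda>_. borel) Y {1..}"
    and distr: "\<And>i. 1 \<le> i \<Longrightarrow> distr M borel (Y i) = distr M borel Z"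
    and Z: "random_variable borel Z" "AE x in M. Z x \<in> {a..b}" and ab: "a < b"
  shows "AE x in M. (\<lambda>n. (\<Sum>i=1..n. Y i x) / n) \<longlonglongrightarrow> expectation Z"
proof -
  let ?S = "\<lambda>n x. (\<Sum>i=1..n. Y i x) / real n"
  have Y[measurable]: "random_variable borel (Y i)" if "1 \<le> i" for i
    using indep that unfolding indep_vars_def2 by auto
  have S[measurable]: "random_variable borel (?S n)" for n
    by (intro borel_measurable_divide borel_measurable_sum) auto
  have "AE x in M. \<forall>\<^sub>F n in sequentially. \<bar>?S n x - expectation Z\<bar> < e" if e: "e > 0" for e :: real
  proof -
    let ?A = "\<lambda>n. {x \<in> space M. \<bar>?S n x - expectation Z\<bar> \<ge> e}"
    let ?q = "exp (- (2 * e\<^sup>2 / (b - a)\<^sup>2))"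
    have q: "0 < ?q" "?q < 1" using e ab by auto
    have bound: "prob (?A n) \<le> 2 * ?q ^ n" if n: "n \<ge> 1" for n
    proof -
      interpret H: Hoeffding_ineq_iid M "{1..n}" Y Z a b "expectation Z"
      proof unfold_locales
        show "indep_vars (\<lambda>_. borel) Y {1..n}"
          by (rule indep_vars_subset[OF indep]) auto
        show "distr M borel (Y i) = distr M borel Z" if "i \<in> {1..n}" for i
          by (rule distr) (use that in simp)
      qed (use Z in simp_all)
      have "prob (?A n) \<le> 2 * exp (- 2 * real n * e\<^sup>2 / (b - a)\<^sup>2)"
        using H.Hoeffding_ineq_abs_ge'[of e] e ab n by simp
      also have "exp (- 2 * real n * e\<^sup>2 / (b - a)\<^sup>2) = ?q ^ n"
        unfolding exp_of_nat_mult[symmetric] by (simp add: mult_ac)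
      finally show ?thesis .
    qed
    have "summable (\<lambda>n. 2 * ?q ^ n)"
      by (rule summable_mult, rule summable_geometric) (use q in simp)
    then have "summable (\<lambda>n. prob (?A n))"
    proof (rule summable_comparison_test')
      show "norm (prob (?A n)) \<le> 2 * ?q ^ n" if "n \<ge> 1" for n
        using bound[OF that] by (subst real_norm_def, subst abs_of_nonneg[OF measure_nonneg])
    qed
    then have "AE x in M. \<forall>\<^sub>F n in sequentially. x \<in> space M - ?A n"
      by (intro borel_cantelli_AE1) (auto simp: emeasure_eq_measure)
    then show ?thesis
      by (rule AE_mp) (auto intro!: AE_I2 elim!: eventually_mono)
  qed
  then have "AE x in M. \<forall>k. \<forall>\<^sub>F n in sequentially. \<bar>?S n x - expectation Z\<bar> < inverse (real (Suc k))"
    unfolding AE_all_countable by simp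
  then show ?thesis
  proof (rule AE_mp, intro AE_I2 impI)
    fix x assume *: "\<forall>k. \<forall>\<^sub>F n in sequentially. \<bar>?S n x - expectation Z\<bar> < inverse (real (Suc k))"
    show "(\<lambda>n. ?S n x) \<longlonglongrightarrow> expectation Z"
    proof (rule tendstoI)
      fix e :: real assume "e > 0"
      then obtain k where "inverse (real (Suc k)) < e" using reals_Archimedean by blast
      with *[rule_format, of k] show "\<forall>\<^sub>F n in sequentially. dist (?S n x) (expectation Z) < e"
        by (auto elim!: eventually_mono simp: dist_real_def)
    qed
  qed
qed

text \<open>On the first \<open>N\<close> cells \<open>g\<close> is replaced by its value at the
  centre, at cost \<open>e\<close>; elsewhere only the bound \<open>C\<close> is used. The lemma
  serves both the law of \<open>X\<close> and the empirical distributions.\<close>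

lemma (in prob_space) expectation_partition_approx:
  fixes X :: "'a \<Rightarrow> 'b::metric_space" and g :: "'b \<Rightarrow> real"
  assumes X[measurable]: "random_variable borel X" and g[measurable]: "g \<in> borel_measurable borel"
    and disj: "disjoint_family A" and A[measurable]: "\<And>j. A j \<in> sets borel"
    and ball: "\<And>j. A j \<subseteq> ball (c j) d"
    and bound: "\<And>x. \<bar>g x\<bar> \<le> C" and close: "\<And>x y. dist x y < d \<Longrightarrow> \<bar>g x - g y\<bar> \<le> e"
    and e: "0 \<le> e"
  shows "\<bar>expectation (\<lambda>w. g (X w)) - (\<Sum>j<N::nat. g (c j) * expectation (\<lambda>w. indicat_real (A j) (X w)))\<bar>
    \<le> e + C * expectation (\<lambda>w. indicat_real (- (\<Union>j<N. A j)) (X w))"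
proof -
  define B where "B = - (\<Union>j<N. A j)"
  have B[measurable]: "B \<in> sets borel" unfolding B_def by measurable
  define h where "h x = (\<Sum>j<N. g (c j) * indicat_real (A j) x)" for x
  have intA: "integrable M (\<lambda>w. indicat_real (A j) (X w))" for j
    by (rule integrable_const_bound[of _ 1]) auto
  have intB: "integrable M (\<lambda>w. indicat_real B (X w))"
    by (rule integrable_const_bound[of _ 1]) auto
  have intg: "integrable M (\<lambda>w. g (X w))"
    by (rule integrable_const_bound[of _ C]) (use bound in auto)
  have inth: "integrable M (\<lambda>w. h (X w))"
    unfolding h_def using intA by (intro Bochner_Integration.integrable_sum integrable_mult_right) auto
  have pw: "\<bar>g x - h x\<bar> \<le> e + C * indicat_real B x" for x
  proof (cases "x \<in> B")
    case True
    then have "h x = 0" unfolding h_def B_def by (intro sum.neutral) auto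
    then show ?thesis using True bound[of x] e by simp
  next
    case False
    then obtain j where j: "j < N" "x \<in> A j" by (auto simp: B_def)
    have "indicat_real (A i) x = (if i = j then 1 else 0)" for i
      using disj j(2) by (auto simp: disjoint_family_on_def indicator_def)
    then have "h x = (\<Sum>i<N. if i = j then g (c i) else 0)"
      unfolding h_def by (intro sum.cong) auto
    then have "h x = g (c j)" using j(1) by simp
    moreover have "dist x (c j) < d" using subsetD[OF ball j(2)] by (simp add: dist_commute)
    ultimately show ?thesis using close[of x "c j"] False by simp
  qed
  have "\<bar>expectation (\<lambda>w. g (X w)) - expectation (\<lambda>w. h (X w))\<bar> = \<bar>expectation (\<lambda>w. g (X w) - h (X w))\<bar>"
    using intg inth by simp
  also have "\<dots> \<le> expectation (\<lambda>w. \<bar>g (X w) - h (X w)\<bar>)" by (rule integral_abs_bound)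
  also have "\<dots> \<le> expectation (\<lambda>w. e + C * indicat_real B (X w))"
    using intg inth intB pw by (intro integral_mono) auto
  also have "\<dots> = e + C * expectation (\<lambda>w. indicat_real B (X w))"
    using intB by (simp add: prob_space)
  finally have "\<bar>expectation (\<lambda>w. g (X w)) - expectation (\<lambda>w. h (X w))\<bar>
    \<le> e + C * expectation (\<lambda>w. indicat_real B (X w))" .
  moreover have "expectation (\<lambda>w. h (X w))
      = (\<Sum>j<N. g (c j) * expectation (\<lambda>w. indicat_real (A j) (X w)))"
    unfolding h_def
    by (subst Bochner_Integration.integral_sum) (auto intro: intA)
  ultimately show ?thesis by (simp add: B_def)
qed

text \<open>Equicontinuity and a partition into small cells reduce all of \<open>G\<close> to
  finitely many cell frequencies, whose deviations do not depend on \<open>g\<close> and obey the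
  scalar strong law.\<close>

lemma (in prob_space) uniform_strong_law:
  fixes X :: "'a \<Rightarrow> 'b::{metric_space,second_countable_topology}" and G :: "('b \<Rightarrow> real) set"
  assumes indep: "indep_vars (\<lambda>_. borel) Xs {1..}"
    and distr: "\<And>i. 1 \<le> i \<Longrightarrow> distr M borel (Xs i) = distr M borel X"
    and X[measurable]: "random_variable borel X"
    and bound: "\<And>g x. g \<in> G \<Longrightarrow> \<bar>g x\<bar> \<le> C"
    and equicont: "\<And>e. e > 0 \<Longrightarrow> \<exists>d>0. \<forall>g\<in>G. \<forall>x y. dist x y < d \<longrightarrow> \<bar>g x - g y\<bar> < e"
  shows "AE \<omega> in M. uniform_limit G (\<lambda>n g. (\<Sum>i=1..n. g (Xs i \<omega>)) / n)
    (\<lambda>g. expectation (\<lambda>w. g (X w))) sequentially"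
proof (cases "G = {}")
  case True
  then show ?thesis by simp
next
  case False
  have C: "0 \<le> C" using bound False by (meson abs_ge_zero all_not_in_conv order_trans)
  have Xs[measurable]: "random_variable borel (Xs i)" if "1 \<le> i" for i
    using indep that unfolding indep_vars_def2 by auto
  have g_meas: "g \<in> borel_measurable borel" if "g \<in> G" for g
  proof -
    have "isCont g x" for x
      using equicont that unfolding continuous_at_eps_delta dist_real_def
      by (metis dist_commute)
    then show ?thesis
      by (intro borel_measurable_continuous_onI continuous_at_imp_continuous_on) auto
  qed
  let ?S = "\<lambda>g n \<omega>. (\<Sum>i=1..n. g (Xs i \<omega>)) / real n"
  let ?E = "\<lambda>g. expectation (\<lambda>w. g (X w)) :: real"
  have key: "AE \<omega> in M. \<forall>\<^sub>F n in sequentially. \<forall>g\<in>G. \<bar>?S g n \<omega> - ?E g\<bar> < e" if e: "e > 0" for e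
  proof -
    \<comment> \<open>The error budget has four quarters: the discretization and the mass outside
      the first cells, each once for the sample average and once for the expectation.\<close>
    obtain d where d: "d > 0" "\<And>g x y. g \<in> G \<Longrightarrow> dist x y < d \<Longrightarrow> \<bar>g x - g y\<bar> < e / 4"
      using equicont[of "e / 4"] e by (auto 0 3)
    obtain D :: "'b set" where D: "countable D" "\<And>U. open U \<Longrightarrow> U \<noteq> {} \<Longrightarrow> \<exists>x\<in>D. x \<in> U"
      using countable_dense_setE by blast
    define c where "c = from_nat_into D"
    have "D \<noteq> {}" using D(2)[of UNIV] by auto
    then have rc: "range c = D" unfolding c_def using D(1) by (rule range_from_nat_into)
    \<comment> \<open>Making the balls around a dense sequence disjoint yields a countable
      measurable partition into small cells.\<close>
    define A where "A = disjointed (\<lambda>j. ball (c j) d)"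
    define B where "B N = - (\<Union>j<N. A j)" for N :: nat
    have A[measurable]: "A j \<in> sets borel" for j unfolding A_def disjointed_def by measurable
    have B[measurable]: "B N \<in> sets borel" for N
      unfolding B_def by (rule borel_comp) measurable
    have ball: "A j \<subseteq> ball (c j) d" for j unfolding A_def by (rule disjointed_subset)
    have disj: "disjoint_family A" unfolding A_def by (rule disjoint_family_disjointed)
    have cover: "(\<Union>j. A j) = UNIV"
    proof -
      have "x \<in> (\<Union>j. ball (c j) d)" for x
        using D(2)[of "ball x d"] d(1) rc by (fastforce simp: dist_commute)
      then show ?thesis unfolding A_def UN_disjointed_eq by blast
    qed
    \<comment> \<open>The uncovered sets decrease to the empty set, so finitely many cells carry
      nearly all the mass of the law of \<open>X\<close>.\<close>
    have decB: "decseq B" by (auto simp: decseq_def B_def)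
    interpret DX: prob_space "distr M borel X" by (rule prob_space_distr) simp
    have "(\<lambda>N. measure (distr M borel X) (B N)) \<longlonglongrightarrow> measure (distr M borel X) (\<Inter>N. B N)"
      using B decB by (intro DX.finite_Lim_measure_decseq) auto
    moreover have "(\<Inter>N. B N) = {}" using cover unfolding B_def by fastforce
    ultimately have "(\<lambda>N. measure (distr M borel X) (B N)) \<longlonglongrightarrow> 0" by simp
    moreover have "measure (distr M borel X) (B N) = ?E (indicat_real (B N))" for N
      using integral_distr[OF X, of "indicat_real (B N)"] by simp
    ultimately have "(\<lambda>N. C * ?E (indicat_real (B N))) \<longlonglongrightarrow> C * 0"
      by (intro tendsto_mult tendsto_const) simp
    then have "\<forall>\<^sub>F N in sequentially. C * ?E (indicat_real (B N)) < e / 4"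
      using e by (intro order_tendstoD(2)) auto
    then obtain N where N: "C * ?E (indicat_real (B N)) < e / 4"
      by (auto simp: eventually_sequentially)
    have law: "AE \<omega> in M. (\<lambda>n. ?S (indicat_real V) n \<omega>) \<longlonglongrightarrow> ?E (indicat_real V)"
      if V[measurable]: "V \<in> sets borel" for V
    proof (rule strong_law_bounded[where a = 0 and b = 1])
      show "indep_vars (\<lambda>_. borel) (\<lambda>i \<omega>. indicat_real V (Xs i \<omega>)) {1..}"
        by (rule indep_vars_compose2[OF indep]) simp
      fix i :: nat assume i: "1 \<le> i"
      have "distr M borel (\<lambda>w. indicat_real V (Xs i w)) = distr (distr M borel (Xs i)) borel (indicat_real V)"
        using i by (subst distr_distr) (auto simp: comp_def)
      also have "\<dots> = distr M borel (\<lambda>w. indicat_real V (X w))"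
        unfolding distr[OF i] by (subst distr_distr) (auto simp: comp_def)
      finally show "distr M borel (\<lambda>w. indicat_real V (Xs i w)) = distr M borel (\<lambda>w. indicat_real V (X w))" .
    qed (auto intro!: AE_I2 simp: indicator_def)
    have "AE \<omega> in M. \<forall>j. (\<lambda>n. ?S (indicat_real (A j)) n \<omega>) \<longlonglongrightarrow> ?E (indicat_real (A j))"
      unfolding AE_all_countable using law by simp
    with law[OF B[of N]] show ?thesis
    proof eventually_elim
      fix \<omega>
      assume limB: "(\<lambda>n. ?S (indicat_real (B N)) n \<omega>) \<longlonglongrightarrow> ?E (indicat_real (B N))"
        and limA: "\<forall>j. (\<lambda>n. ?S (indicat_real (A j)) n \<omega>) \<longlonglongrightarrow> ?E (indicat_real (A j))"
      \<comment> \<open>A bound free of \<open>g\<close>. Its deviation terms vanish in the limit,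
        and the choice of \<open>N\<close> makes what remains less than \<open>e\<close>.\<close>
      define T where "T n = (e / 4 + C * ?S (indicat_real (B N)) n \<omega>) + (e / 4 + C * ?E (indicat_real (B N)))
        + (\<Sum>j<N. C * \<bar>?S (indicat_real (A j)) n \<omega> - ?E (indicat_real (A j))\<bar>)" for n
      have "T \<longlonglongrightarrow> (e / 4 + C * ?E (indicat_real (B N))) + (e / 4 + C * ?E (indicat_real (B N)))
        + (\<Sum>j<N. C * \<bar>?E (indicat_real (A j)) - ?E (indicat_real (A j))\<bar>)"
        unfolding T_def using limA limB by (intro tendsto_intros) auto
      then have Te: "\<forall>\<^sub>F n in sequentially. T n < e"
        by (rule order_tendstoD(2)) (use N in simp)
      have le_T: "\<bar>?S g n \<omega> - ?E g\<bar> \<le> T n" if g: "g \<in> G" and n: "1 \<le> n" for g n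
      proof -
        \<comment> \<open>A sample average is an expectation under the uniform distribution on the
          indices, so the partition estimate applies to it as well.\<close>
        let ?U = "uniform_count_measure {1..n}"
        let ?H = "\<lambda>L. \<Sum>j<N. g (c j) * L (indicat_real (A j))"
        interpret U: prob_space ?U by (rule prob_space_uniform_count_measure) (use n in auto)
        have U: "integral\<^sup>L ?U (\<lambda>i. f (Xs i \<omega>)) = ?S f n \<omega>" for f
          by (subst integral_uniform_count_measure) auto
        have "\<bar>?S g n \<omega> - ?H (\<lambda>f. ?S f n \<omega>)\<bar> \<le> e / 4 + C * ?S (indicat_real (B N)) n \<omega>"
          unfolding B_def U[symmetric]
        proof (rule U.expectation_partition_approx[OF _ g_meas[OF g] disj A ball bound[OF g]])
          show "(\<lambda>i. Xs i \<omega>) \<in> borel_measurable ?U"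
            by (subst measurable_cong_sets[OF sets_uniform_count_measure_count_space refl]) simp
        qed (use less_imp_le[OF d(2)[OF g]] e in auto)
        moreover have "\<bar>?E g - ?H ?E\<bar> \<le> e / 4 + C * ?E (indicat_real (B N))"
          unfolding B_def
          by (rule expectation_partition_approx[OF X g_meas[OF g] disj A ball bound[OF g]])
            (use less_imp_le[OF d(2)[OF g]] e in auto)
        moreover have "\<bar>?H (\<lambda>f. ?S f n \<omega>) - ?H ?E\<bar>
          \<le> (\<Sum>j<N. C * \<bar>?S (indicat_real (A j)) n \<omega> - ?E (indicat_real (A j))\<bar>)"
          unfolding sum_subtractf[symmetric] right_diff_distrib[symmetric]
          by (rule order_trans[OF sum_abs])
            (auto simp: abs_mult intro!: sum_mono mult_right_mono bound[OF g])
        ultimately show ?thesis unfolding T_def by linarith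
      qed
      show "\<forall>\<^sub>F n in sequentially. \<forall>g\<in>G. \<bar>?S g n \<omega> - ?E g\<bar> < e"
        using Te eventually_ge_at_top[of 1]
        by eventually_elim (use le_T le_less_trans in blast)
    qed
  qed
  have "AE \<omega> in M. \<forall>k. \<forall>\<^sub>F n in sequentially. \<forall>g\<in>G. \<bar>?S g n \<omega> - ?E g\<bar> < inverse (real (Suc k))"
    unfolding AE_all_countable using key by simp
  then show ?thesis
  proof eventually_elim
    fix \<omega>
    assume *: "\<forall>k. \<forall>\<^sub>F n in sequentially. \<forall>g\<in>G. \<bar>?S g n \<omega> - ?E g\<bar> < inverse (real (Suc k))"
    show "uniform_limit G (\<lambda>n g. ?S g n \<omega>) ?E sequentially"
    proof (rule uniform_limitI)
      fix e :: real assume "e > 0"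
      then obtain k where "inverse (real (Suc k)) < e" using reals_Archimedean by blast
      with *[rule_format, of k] show "\<forall>\<^sub>F n in sequentially. \<forall>g\<in>G. dist (?S g n \<omega>) (?E g) < e"
        by (auto elim!: eventually_mono simp: dist_real_def)
    qed
  qed
qed

section \<open>Intrinsic means of acute distributions\<close>

lemma measurable_hsphere_borelD: "X \<in> measurable M hsphere_borel \<Longrightarrow> X \<in> borel_measurable M"
  using measurable_cong_sets[OF refl sets_hsphere_borel, of M] measurable_restrict_space2_iff
  by blast

text \<open>\<open>U\<close> is any set carrying \<open>X\<close>, not necessarily its support, so
  that finite samples are instances too. \<open>pos\<close> provides the strict inequalities behind
  existence and uniqueness of the mean.\<close>

locale acute_sphere_rv = prob_space M for M :: "'w measure" +
  fixes X :: "'w \<Rightarrow> 'a::{real_inner,polish_space}" and U :: "'a set"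
  assumes X: "X \<in> measurable M hsphere_borel"
    and AE_U: "AE w in M. X w \<in> U"
    and U_sphere: "U \<subseteq> hsphere"
    and acute: "\<And>x y. x \<in> U \<Longrightarrow> y \<in> U \<Longrightarrow> 0 \<le> x \<bullet> y"
    and pos: "\<And>x. x \<in> U \<Longrightarrow> 0 < expectation (\<lambda>w. X w \<bullet> x)"
begin

abbreviation F :: "'a \<Rightarrow> real" where "F \<equiv> frechet_fun M X"

lemma F_eq: "F p = expectation (\<lambda>w. sq_arccos (X w \<bullet> p))"
  by (simp add: frechet_fun_def geod_dist_def)

lemma X_sphere: "w \<in> space M \<Longrightarrow> X w \<in> hsphere"
  using measurable_space[OF X] by simp

lemma X_borel[measurable]: "X \<in> borel_measurable M"
  using X by (rule measurable_hsphere_borelD)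

lemma abs_inner_le: "w \<in> space M \<Longrightarrow> \<bar>X w \<bullet> p\<bar> \<le> norm p"
  using Cauchy_Schwarz_ineq2[of "X w" p] X_sphere[of w] by simp

lemma integrable_inner: "integrable M (\<lambda>w. X w \<bullet> p)"
  by (rule integrable_const_bound[of _ "norm p"]) (auto intro!: AE_I2 abs_inner_le)

lemma F_eq_clipped:
  assumes "p \<in> cball 0 1"
  shows "F p = expectation (\<lambda>w. clipped_sq_arccos p (X w))"
  unfolding F_eq
  by (intro Bochner_Integration.integral_cong refl clipped_sq_arccos_eq[symmetric] order_trans[OF abs_inner_le])
    (use assms in auto)

lemma integrable_clipped: "integrable M (\<lambda>w. clipped_sq_arccos p (X w))"
proof (rule integrable_const_bound[of _ "pi\<^sup>2"])
  show "(\<lambda>w. clipped_sq_arccos p (X w)) \<in> borel_measurable M"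
    using borel_measurable_continuous_onI[OF continuous_on_clipped_sq_arccos] X_borel
    by (rule measurable_compose_rev)
qed (use clipped_sq_arccos_le in auto)

lemma integrable_sq_arccos:
  assumes "p \<in> cball 0 1"
  shows "integrable M (\<lambda>w. sq_arccos (X w \<bullet> p))"
proof -
  have "integrable M (\<lambda>w. sq_arccos (X w \<bullet> p)) \<longleftrightarrow> integrable M (\<lambda>w. clipped_sq_arccos p (X w))"
    by (intro Bochner_Integration.integrable_cong refl clipped_sq_arccos_eq[symmetric]
        order_trans[OF abs_inner_le]) (use assms in auto)
  then show ?thesis using integrable_clipped by simp
qed

lemma continuous_on_F: "continuous_on hsphere F"
  unfolding continuous_on_iff
proof (intro ballI allI impI)
  fix p :: 'a and e :: real assume p: "p \<in> hsphere" and e: "0 < e"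
  then obtain d where d: "d > 0" "\<And>x p q :: 'a. x \<in> cball 0 1 \<Longrightarrow> dist p q < d \<Longrightarrow>
    \<bar>clipped_sq_arccos x p - clipped_sq_arccos x q\<bar> < e / 2"
    using clipped_sq_arccos_equicontinuous[of "e / 2"] by (metis half_gt_zero)
  have "dist (F q) (F p) < e" if q: "q \<in> hsphere" "dist q p < d" for q
  proof -
    have "\<bar>F q - F p\<bar> = \<bar>expectation (\<lambda>w. clipped_sq_arccos q (X w) - clipped_sq_arccos p (X w))\<bar>"
      using p q integrable_clipped by (simp add: F_eq_clipped)
    also have "\<dots> \<le> expectation (\<lambda>w. \<bar>clipped_sq_arccos q (X w) - clipped_sq_arccos p (X w)\<bar>)"
      by (rule integral_abs_bound)
    also have "\<dots> \<le> expectation (\<lambda>w. e / 2)"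
    proof (intro integral_mono Bochner_Integration.integrable_abs Bochner_Integration.integrable_diff
        integrable_clipped)
      fix w assume "w \<in> space M"
      \<comment> \<open>The roles are exchanged: \<open>X w\<close> is the parameter and
        \<open>p\<close>, \<open>q\<close> are the arguments, so equicontinuity yields continuity in
        \<open>p\<close>.\<close>
      then have "X w \<in> cball 0 1" using X_sphere[of w] by simp
      from d(2)[OF this q(2)]
      show "\<bar>clipped_sq_arccos q (X w) - clipped_sq_arccos p (X w)\<bar> \<le> e / 2"
        by (simp add: clipped_sq_arccos_commute[of q] clipped_sq_arccos_commute[of p])
    qed simp
    also have "\<dots> < e" using e by (simp add: prob_space)
    finally show ?thesis by (simp add: dist_real_def)
  qed
  then show "\<exists>d>0. \<forall>x'\<in>hsphere. dist x' p < d \<longrightarrow> dist (F x') (F p) < e" using d(1) by blast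
qed

text \<open>The slope bound \<open>sq_arccos_diff_le\<close>, integrated; comparing inner products
  on \<open>U\<close> is enough because \<open>X\<close> lies there almost surely.\<close>

lemma F_decrease:
  assumes p: "p \<in> hsphere" "q \<in> hsphere" and le: "\<And>x. x \<in> U \<Longrightarrow> x \<bullet> p \<le> x \<bullet> q"
  shows "F q \<le> F p - 2 * expectation (\<lambda>w. X w \<bullet> (q - p))"
proof -
  have "F q \<le> expectation (\<lambda>w. sq_arccos (X w \<bullet> p) - 2 * (X w \<bullet> (q - p)))"
    unfolding F_eq
  proof (intro integral_mono_AE)
    show "AE w in M. sq_arccos (X w \<bullet> q) \<le> sq_arccos (X w \<bullet> p) - 2 * (X w \<bullet> (q - p))"
      using AE_U
    proof eventually_elim
      case (elim w)
      then have "X w \<in> hsphere" using U_sphere by blast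
      then show ?case
        using sq_arccos_diff_le[of "X w \<bullet> p" "X w \<bullet> q"] le[OF elim] p
          abs_inner_hsphere_le[of "X w" p] abs_inner_hsphere_le[of "X w" q]
        by (simp add: inner_diff_right abs_le_iff)
    qed
  qed (use p integrable_sq_arccos integrable_inner in auto)
  also have "\<dots> = F p - 2 * expectation (\<lambda>w. X w \<bullet> (q - p))"
    using p integrable_sq_arccos integrable_inner by (simp add: F_eq)
  finally show ?thesis .
qed

lemma F_antimono:
  assumes p: "p \<in> hsphere" "q \<in> hsphere" and le: "\<And>x. x \<in> U \<Longrightarrow> x \<bullet> p \<le> x \<bullet> q"
  shows "F q \<le> F p"
proof -
  have "0 \<le> expectation (\<lambda>w. X w \<bullet> (q - p))"
    using AE_U by (intro integral_nonneg_AE) (auto elim!: eventually_mono simp: inner_diff_right le)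
  then show ?thesis using F_decrease[OF assms] by simp
qed

lemma U_nonempty: "U \<noteq> {}"
  using AE_U AE_const by fastforce

text \<open>By acuteness the slope bound can start at inner product 0. With \<open>pos\<close>, the
  value is strictly below the level \<open>(pi / 2)\<^sup>2\<close> of orthogonality.\<close>

lemma F_upper:
  assumes x: "x \<in> U"
  shows "F x \<le> (pi / 2)\<^sup>2 - 2 * expectation (\<lambda>w. X w \<bullet> x)"
proof -
  have xS: "x \<in> hsphere" using x U_sphere by blast
  have "F x \<le> expectation (\<lambda>w. (pi / 2)\<^sup>2 - 2 * (X w \<bullet> x))"
    unfolding F_eq
  proof (intro integral_mono_AE)
    show "AE w in M. sq_arccos (X w \<bullet> x) \<le> (pi / 2)\<^sup>2 - 2 * (X w \<bullet> x)"
      using AE_U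
    proof eventually_elim
      case (elim w)
      then show ?case
        using sq_arccos_diff_le[of 0 "X w \<bullet> x"] acute[OF elim x] xS U_sphere
          abs_inner_hsphere_le[of "X w" x] by auto
    qed
  qed (use xS integrable_sq_arccos integrable_inner in auto)
  also have "\<dots> = (pi / 2)\<^sup>2 - 2 * expectation (\<lambda>w. X w \<bullet> x)"
    using integrable_inner by (simp add: prob_space)
  finally show ?thesis .
qed

text \<open>The tangent bound at 0, integrated. It keeps the mean inner product of near-minimizers
  away from 0, which gives a uniform convexity constant.\<close>

lemma expectation_inner_lower:
  assumes p: "p \<in> hsphere" "p \<in> dual_cone U" and F: "F p \<le> (pi / 2)\<^sup>2 - b"
  shows "b / pi \<le> expectation (\<lambda>w. X w \<bullet> p)"
proof -
  have "(pi / 2)\<^sup>2 - pi * expectation (\<lambda>w. X w \<bullet> p) = expectation (\<lambda>w. (pi / 2)\<^sup>2 - pi * (X w \<bullet> p))"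
    using integrable_inner by (simp add: prob_space)
  also have "\<dots> \<le> F p"
    unfolding F_eq
  proof (intro integral_mono_AE)
    show "AE w in M. (pi / 2)\<^sup>2 - pi * (X w \<bullet> p) \<le> sq_arccos (X w \<bullet> p)"
      using AE_U
    proof eventually_elim
      case (elim w)
      then have "0 \<le> X w \<bullet> p" "X w \<bullet> p \<le> 1"
        using p U_sphere abs_inner_hsphere_le[of "X w" p] by (auto simp: dual_cone_def)
      then show ?case using sq_arccos_ge_tangent_0[of "X w \<bullet> p"] by simp
    qed
  qed (use p integrable_sq_arccos integrable_inner in auto)
  finally have "b \<le> pi * expectation (\<lambda>w. X w \<bullet> p)" using F by simp
  then show ?thesis by (simp add: field_simps)
qed

text \<open>Convexity of the squared arccosine alone gives no modulus that is uniform in infinite dimension.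
  The gain comes from rescaling the chord midpoint, whose norm is less than 1, to the sphere.\<close>

lemma F_strongly_midconvex:
  assumes p: "p \<in> hsphere" "p \<in> dual_cone U" "c \<le> expectation (\<lambda>w. X w \<bullet> p)"
    and q: "q \<in> hsphere" "q \<in> dual_cone U" "c \<le> expectation (\<lambda>w. X w \<bullet> q)"
    and c: "0 < c"
  shows "sgn (p + q) \<in> hsphere"
    and "F (sgn (p + q)) \<le> (F p + F q) / 2 - c * (1 - p \<bullet> q) / 2"
proof -
  \<comment> \<open>A positive mean inner product excludes antipodal \<open>p\<close> and
    \<open>q\<close>, so the midpoint can be normalized.\<close>
  have "expectation (\<lambda>w. X w \<bullet> (p + q)) \<ge> c + c"
    using p(3) q(3) integrable_inner by (simp add: inner_add_right)
  then have nz: "p + q \<noteq> 0" using c by auto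
  then show S: "sgn (p + q) \<in> hsphere" by (simp add: norm_sgn)
  define l where "l = norm (p + q) / 2"
  have l0: "l > 0" using nz by (simp add: l_def)
  have l1: "l \<le> 1" unfolding l_def using norm_triangle_ineq[of p q] p q by simp
  have "p \<bullet> p = 1" "q \<bullet> q = 1" using p q by (auto simp: dot_square_norm)
  then have l2: "l\<^sup>2 = (1 + p \<bullet> q) / 2"
    unfolding l_def power_divide power2_norm_eq_inner
    by (simp add: inner_add_left inner_add_right inner_commute)
  \<comment> \<open>Normalizing the midpoint multiplies inner products by \<open>1 / l\<close>; this
    chain bounds the excess \<open>1 / l - 1\<close> from below by a quarter of
    \<open>1 - p \<bullet> q\<close>.\<close>
  have "(1 - l) * ((1 + l) / 2) \<le> (1 - l) * 1" using l1 by (intro mult_left_mono) auto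
  then have "(1 - l) * (1 + l) / 2 \<le> 1 - l" by simp
  also have "\<dots> \<le> (1 - l) / l"
    using divide_left_mono[of l 1 "1 - l"] l0 l1 by simp
  also have "\<dots> = 1 / l - 1" using l0 by (simp add: field_simps)
  finally have "(1 - l\<^sup>2) / 2 \<le> 1 / l - 1" by (simp add: algebra_simps power2_eq_square)
  then have gain: "(1 - p \<bullet> q) / 4 \<le> 1 / l - 1" unfolding l2 by (simp add: field_simps)
  have "F (sgn (p + q)) \<le> expectation (\<lambda>w. (sq_arccos (X w \<bullet> p) + sq_arccos (X w \<bullet> q)) / 2
      - (1 - p \<bullet> q) / 4 * (X w \<bullet> p + X w \<bullet> q))"
    unfolding F_eq
  proof (intro integral_mono_AE)
    show "AE w in M. sq_arccos (X w \<bullet> sgn (p + q)) \<le> (sq_arccos (X w \<bullet> p) + sq_arccos (X w \<bullet> q)) / 2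
      - (1 - p \<bullet> q) / 4 * (X w \<bullet> p + X w \<bullet> q)"
      using AE_U
    proof eventually_elim
      case (elim w)
      let ?x = "X w"
      have xS: "?x \<in> hsphere" using elim U_sphere by blast
      define s where "s = (?x \<bullet> p + ?x \<bullet> q) / 2"
      have xp: "0 \<le> ?x \<bullet> p" "?x \<bullet> p \<le> 1" "0 \<le> ?x \<bullet> q" "?x \<bullet> q \<le> 1"
        using p q elim abs_inner_hsphere_le[OF xS p(1)] abs_inner_hsphere_le[OF xS q(1)]
        by (auto simp: dual_cone_def)
      have s0: "0 \<le> s" using xp by (simp add: s_def)
      have sl: "?x \<bullet> sgn (p + q) = s / l"
        unfolding sgn_div_norm s_def l_def using nz by (simp add: inner_add_right field_simps)
      \<comment> \<open>Membership in the dual cone makes \<open>s\<close> nonnegative, so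
        normalizing raises the inner product, and the slope bound turns the rise into a decrease of
        \<open>sq_arccos\<close>.\<close>
      have "s \<le> s / l" using s0 l0 l1 by (simp add: field_simps mult_left_le_one_le)
      moreover have "s / l \<le> 1" using abs_inner_hsphere_le[OF xS S] unfolding sl abs_le_iff by simp
      ultimately have "sq_arccos (s / l) \<le> sq_arccos s - 2 * (s / l - s)"
        using s0 by (intro sq_arccos_diff_le) auto
      moreover have "sq_arccos s \<le> (sq_arccos (?x \<bullet> p) + sq_arccos (?x \<bullet> q)) / 2"
        unfolding s_def using xp by (intro sq_arccos_midpoint) auto
      moreover
      define g where "g = (1 - p \<bullet> q) / 4 * s"
      have "g \<le> s / l - s" unfolding g_def
        using mult_right_mono[OF gain s0] by (simp add: left_diff_distrib)
      ultimately have "sq_arccos (s / l) \<le> (sq_arccos (?x \<bullet> p) + sq_arccos (?x \<bullet> q)) / 2 - 2 * g"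
        by argo
      also have "2 * g = (1 - p \<bullet> q) / 4 * (?x \<bullet> p + ?x \<bullet> q)" by (simp add: s_def g_def)
      finally show ?case unfolding sl .
    qed
  qed (use p q S integrable_sq_arccos integrable_inner in auto)
  also have "\<dots> = (F p + F q) / 2
      - (1 - p \<bullet> q) / 4 * (expectation (\<lambda>w. X w \<bullet> p) + expectation (\<lambda>w. X w \<bullet> q))"
    using p q integrable_sq_arccos integrable_inner by (simp add: F_eq)
  also have "\<dots> \<le> (F p + F q) / 2 - (1 - p \<bullet> q) / 4 * (c + c)"
    using p q abs_inner_hsphere_le[OF p(1) q(1)]
    by (intro diff_left_mono mult_left_mono add_mono) auto
  finally show "F (sgn (p + q)) \<le> (F p + F q) / 2 - c * (1 - p \<bullet> q) / 2"
    by (simp add: field_simps)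
qed

text \<open>Acuteness says \<open>U \<subseteq> dual_cone U\<close>, and taking dual cones reverses
  inclusions.\<close>

lemma bidual_subset_dual: "dual_cone (dual_cone U) \<subseteq> dual_cone U"
  by (rule dual_cone_antimono) (auto simp: dual_cone_def acute)

lemma minimizer_on_cone:
  "\<exists>p\<in>hsphere \<inter> dual_cone (dual_cone U). \<forall>q\<in>hsphere \<inter> dual_cone (dual_cone U). F p \<le> F q"
proof (rule exists_minimizer)
  let ?A = "hsphere \<inter> dual_cone (dual_cone U)"
  show "closed ?A" by (intro closed_Int closed_dual_cone closed_hsphere)
  obtain x where x: "x \<in> U" using U_nonempty by blast
  then have xA: "x \<in> ?A" using U_sphere subset_bidual_cone by blast
  then show "?A \<noteq> {}" by blast
  show "continuous_on ?A F" by (rule continuous_on_subset[OF continuous_on_F]) simp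
  have "0 \<le> F p" for p unfolding F_eq by (rule Bochner_Integration.integral_nonneg) simp
  then show bdd: "bdd_below (F ` ?A)" by (intro bdd_belowI[of _ 0]) auto
  let ?I = "Inf (F ` ?A)"
  define b where "b = expectation (\<lambda>w. X w \<bullet> x)"
  have b: "b > 0" unfolding b_def by (rule pos[OF x])
  have Ib: "?I \<le> (pi / 2)\<^sup>2 - 2 * b"
    using cInf_lower[OF imageI[OF xA] bdd] F_upper[OF x] unfolding b_def by linarith
  fix e :: real assume e: "e > 0"
  define c where "c = b / pi"
  have c: "c > 0" using b by (simp add: c_def)
  \<comment> \<open>The term \<open>b\<close> keeps \<open>F\<close> below
    \<open>(pi / 2)\<^sup>2 - b\<close>, so that \<open>c\<close> bounds the mean inner products;
    the other term turns the convexity gain into \<open>dist p q < e\<close>.\<close>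
  define d where "d = min b (c * e\<^sup>2 / 4)"
  have "dist p q < e" if A: "p \<in> ?A" "q \<in> ?A" and F: "F p < ?I + d" "F q < ?I + d" for p q
  proof -
    have low: "c \<le> expectation (\<lambda>w. X w \<bullet> r)" if "r \<in> ?A" "F r < ?I + d" for r
      unfolding c_def using that bidual_subset_dual Ib
      by (intro expectation_inner_lower) (auto simp: d_def)
    have mid: "sgn (p + q) \<in> hsphere" "F (sgn (p + q)) \<le> (F p + F q) / 2 - c * (1 - p \<bullet> q) / 2"
      using F_strongly_midconvex[OF _ _ low[OF A(1) F(1)] _ _ low[OF A(2) F(2)] c]
        A bidual_subset_dual by auto
    have "sgn (p + q) \<in> ?A"
      using mid A by (auto intro: sgn_in_dual_cone dual_cone_add)
    then have "?I \<le> F (sgn (p + q))" by (intro cInf_lower bdd imageI)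
    then have "c * (1 - p \<bullet> q) / 2 < d" using mid(2) F by argo
    then have "c * (2 * (1 - p \<bullet> q)) < c * e\<^sup>2" by (simp add: d_def mult.left_commute)
    then have "(dist p q)\<^sup>2 < e\<^sup>2" using c A sphere_dist_sq[of p q] by simp
    then show ?thesis using e by (simp add: power2_less_imp_less)
  qed
  then show "\<exists>d>0. \<forall>p\<in>?A. \<forall>q\<in>?A. F p < ?I + d \<longrightarrow> F q < ?I + d \<longrightarrow> dist p q < e"
    using b c e by (intro exI[of _ d]) (auto simp: d_def)
qed

text \<open>Projecting to the cone lowers no inner product with \<open>U\<close>. The projection has
  norm at most 1 and nonnegative inner products with \<open>U\<close>, so normalizing raises them
  further.\<close>

lemma improve_to_cone:
  assumes p: "p \<in> hsphere"
  shows "\<exists>q\<in>hsphere \<inter> dual_cone (dual_cone U). F q \<le> F p"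
proof -
  let ?K = "dual_cone (dual_cone U)"
  obtain q where q: "q \<in> ?K" "(p - q) \<bullet> q = 0" "\<And>k. k \<in> ?K \<Longrightarrow> (p - q) \<bullet> k \<le> 0"
    by (rule convex_cone_projection[of ?K p])
      (auto intro: closed_dual_cone zero_in_dual_cone dual_cone_add dual_cone_scale)
  have le: "x \<bullet> p \<le> x \<bullet> q" if "x \<in> U" for x
    using q(3)[of x] that subset_bidual_cone[of U]
    by (auto simp: inner_diff_left inner_commute[of x])
  show ?thesis
  proof (cases "q = 0")
    \<comment> \<open>Here \<open>p\<close> has no positive inner product with \<open>U\<close>, so
      every point of \<open>U\<close> does at least as well.\<close>
    case True
    obtain x where x: "x \<in> U" using U_nonempty by blast
    then have "F x \<le> F p"
      using p U_sphere le True by (intro F_antimono) (auto intro: order_trans[OF _ acute])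
    then show ?thesis using x U_sphere subset_bidual_cone by blast
  next
    case False
    have "norm q * norm q = p \<bullet> q"
      using q(2) by (simp add: inner_diff_left power2_eq_square[symmetric] power2_norm_eq_inner)
    also have "\<dots> \<le> 1 * norm q" using Cauchy_Schwarz_ineq2[of p q] p by simp
    finally have n1: "norm q \<le> 1" using False by simp
    have "x \<bullet> q \<le> x \<bullet> sgn q" if x: "x \<in> U" for x
    proof -
      have "0 \<le> x \<bullet> q" using q(1) bidual_subset_dual x by (auto simp: dual_cone_def)
      moreover have "1 \<le> inverse (norm q)" using n1 False by (intro one_le_inverse) auto
      ultimately have "1 * (x \<bullet> q) \<le> inverse (norm q) * (x \<bullet> q)" by (intro mult_right_mono)
      then show ?thesis by (simp add: sgn_div_norm)
    qed
    then have "F (sgn q) \<le> F p"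
      using p False le by (intro F_antimono) (auto simp: norm_sgn intro: order_trans)
    moreover have "sgn q \<in> hsphere \<inter> ?K" using q(1) False by (simp add: norm_sgn sgn_in_dual_cone)
    ultimately show ?thesis by blast
  qed
qed

text \<open>Reflecting a point across the hyperplane orthogonal to some \<open>x \<in> U\<close> with \<open>x \<bullet> p < 0\<close>
  brings it closer to all of \<open>U\<close>.\<close>

lemma minimizer_in_dual_cone:
  assumes p: "p \<in> hsphere" and min: "\<And>q. q \<in> hsphere \<Longrightarrow> F p \<le> F q"
  shows "p \<in> dual_cone U"
proof (rule ccontr)
  assume "p \<notin> dual_cone U"
  then obtain x where x: "x \<in> U" "x \<bullet> p < 0" by (auto simp: dual_cone_def not_le)
  have xx: "x \<bullet> x = 1" using x U_sphere by (auto simp: dot_square_norm)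
  define q where "q = p - (2 * (x \<bullet> p)) *\<^sub>R x"
  have "p \<bullet> p = 1" using p by (simp add: dot_square_norm)
  then have "q \<bullet> q = 1"
    using xx by (simp add: q_def inner_diff_left inner_diff_right inner_commute)
  then have qS: "q \<in> hsphere" by (simp add: norm_eq_1)
  have "F q \<le> F p - 2 * expectation (\<lambda>w. X w \<bullet> (q - p))"
  proof (rule F_decrease[OF p qS])
    fix y assume "y \<in> U"
    then have "(x \<bullet> p) * (y \<bullet> x) \<le> 0" using x acute by (intro mult_nonpos_nonneg) auto
    then show "y \<bullet> p \<le> y \<bullet> q" by (simp add: q_def inner_diff_right)
  qed
  also have "expectation (\<lambda>w. X w \<bullet> (q - p)) = - 2 * (x \<bullet> p) * expectation (\<lambda>w. X w \<bullet> x)"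
    by (simp add: q_def)
  finally have "F q \<le> F p + 4 * ((x \<bullet> p) * expectation (\<lambda>w. X w \<bullet> x))" by simp
  moreover have "(x \<bullet> p) * expectation (\<lambda>w. X w \<bullet> x) < 0"
    using x pos by (intro mult_neg_pos) auto
  ultimately show False using min[OF qS] by linarith
qed

text \<open>Minimality of \<open>m\<close> applies at the normalized midpoint of \<open>p\<close>
  and \<open>m\<close>, so the convexity gain is at most half of \<open>F p - F m\<close>. One
  constant is both the admissible excess and the modulus.\<close>

lemma separation:
  assumes m: "m \<in> hsphere" "m \<in> dual_cone U" and min: "\<And>q. q \<in> hsphere \<Longrightarrow> F m \<le> F q"
  obtains b where "0 < b" "\<And>p. p \<in> hsphere \<Longrightarrow> p \<in> dual_cone U \<Longrightarrow> F p \<le> F m + b \<Longrightarrow>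
    b * (1 - p \<bullet> m) \<le> F p - F m"
proof -
  obtain x where x: "x \<in> U" using U_nonempty by blast
  define b where "b = expectation (\<lambda>w. X w \<bullet> x)"
  have b: "b > 0" unfolding b_def by (rule pos[OF x])
  have Fm: "F m \<le> (pi / 2)\<^sup>2 - 2 * b"
    using min[of x] x U_sphere F_upper[OF x] unfolding b_def by auto
  show ?thesis
  proof (rule that)
    show "0 < b / pi" using b by simp
    \<comment> \<open>As \<open>F m\<close> is at least \<open>2 * b\<close> below
      \<open>(pi / 2)\<^sup>2\<close>, an excess of at most \<open>b\<close> leaves the mean inner
      product at least \<open>b / pi\<close>.\<close>
    have "b / pi \<le> b" using b pi_ge_two by (simp add: field_simps)
    fix p assume p: "p \<in> hsphere" "p \<in> dual_cone U" "F p \<le> F m + b / pi"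
    have low: "b / pi \<le> expectation (\<lambda>w. X w \<bullet> r)"
      if "r \<in> hsphere" "r \<in> dual_cone U" "F r \<le> F m + b / pi" for r
      using that Fm \<open>b / pi \<le> b\<close> by (intro expectation_inner_lower) auto
    have "b / pi \<le> expectation (\<lambda>w. X w \<bullet> m)" using low[OF m] b by simp
    note mid = F_strongly_midconvex[OF p(1,2) low[OF p] m this \<open>0 < b / pi\<close>]
    show "b / pi * (1 - p \<bullet> m) \<le> F p - F m" using mid(2) min[OF mid(1)] by argo
  qed
qed

text \<open>The minimizer over the cone is global by \<open>improve_to_cone\<close>. For uniqueness,
  reflection puts every minimizer into \<open>dual_cone U\<close>, where \<open>separation\<close>
  identifies it with \<open>m\<close>.\<close>

theorem intrinsic_mean:
  shows "intrinsic_mean M X \<in> hsphere" and "intrinsic_mean M X \<in> dual_cone (dual_cone U)"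
    and "\<And>q. q \<in> hsphere \<Longrightarrow> F (intrinsic_mean M X) \<le> F q"
proof -
  obtain m where m: "m \<in> hsphere" "m \<in> dual_cone (dual_cone U)"
    and minK: "\<forall>q\<in>hsphere \<inter> dual_cone (dual_cone U). F m \<le> F q"
    using minimizer_on_cone by blast
  have min: "F m \<le> F q" if "q \<in> hsphere" for q
    using improve_to_cone[OF that] minK order_trans by blast
  have mU: "m \<in> dual_cone U" using m bidual_subset_dual by blast
  obtain b where b: "0 < b" "\<And>p. p \<in> hsphere \<Longrightarrow> p \<in> dual_cone U \<Longrightarrow> F p \<le> F m + b \<Longrightarrow>
      b * (1 - p \<bullet> m) \<le> F p - F m"
    using separation[OF m(1) mU min] by metis
  have "intrinsic_mean M X = m"
    unfolding intrinsic_mean_def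
  proof (rule the_equality)
    show "is_arg_min F (\<lambda>p. p \<in> hsphere) m" using m min by (auto simp: is_arg_min_def not_less)
    fix p assume "is_arg_min F (\<lambda>p. p \<in> hsphere) p"
    then have p: "p \<in> hsphere" "\<And>q. q \<in> hsphere \<Longrightarrow> F p \<le> F q"
      by (auto simp: is_arg_min_def not_less)
    then have "b * (1 - p \<bullet> m) \<le> 0"
      using b(2)[of p] b(1) minimizer_in_dual_cone[OF p] p(2)[OF m(1)] by simp
    then have "(dist p m)\<^sup>2 \<le> 0"
      using b(1) sphere_dist_sq[OF p(1) m(1)] by (simp add: mult_le_0_iff)
    then show "p = m" by simp
  qed
  then show "intrinsic_mean M X \<in> hsphere" "intrinsic_mean M X \<in> dual_cone (dual_cone U)"
    "\<And>q. q \<in> hsphere \<Longrightarrow> F (intrinsic_mean M X) \<le> F q"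
    using m min by auto
qed

end

lemma sample_frechet_fun_eq:
  "sample_frechet_fun n x = frechet_fun (uniform_count_measure {1..n}) x"
  by (rule ext) (simp add: sample_frechet_fun_def frechet_fun_def integral_uniform_count_measure)

text \<open>The sample is an acute random element carried by its own points, whose bidual cone lies
  in that of \<open>U\<close>.\<close>

lemma sample_intrinsic_mean:
  fixes x :: "nat \<Rightarrow> 'a::{real_inner,polish_space}"
  assumes n: "1 \<le> n" and x: "\<And>i. i \<in> {1..n} \<Longrightarrow> x i \<in> U" and U: "U \<subseteq> hsphere"
    and acute: "\<And>x y. x \<in> U \<Longrightarrow> y \<in> U \<Longrightarrow> 0 \<le> x \<bullet> y"
  shows "sample_intrinsic_mean n x \<in> hsphere" "sample_intrinsic_mean n x \<in> dual_cone (dual_cone U)"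
    "\<And>q. q \<in> hsphere \<Longrightarrow> sample_frechet_fun n x (sample_intrinsic_mean n x) \<le> sample_frechet_fun n x q"
proof -
  let ?P = "uniform_count_measure {1..n}"
  interpret prob_space ?P by (rule prob_space_uniform_count_measure) (use n in auto)
  interpret S: acute_sphere_rv ?P x "x ` {1..n}"
  proof
    show "x \<in> measurable ?P hsphere_borel"
      using x U by (subst measurable_cong_sets[OF sets_uniform_count_measure_count_space refl])
        (auto simp: measurable_count_space_eq1)
    show "AE i in ?P. x i \<in> x ` {1..n}"
      by (intro AE_I2) (simp add: space_uniform_count_measure)
    show "x ` {1..n} \<subseteq> hsphere" using x U by blast
    show "0 \<le> y \<bullet> z" if "y \<in> x ` {1..n}" "z \<in> x ` {1..n}" for y z
      using that x acute by blast
    show "0 < expectation (\<lambda>i. x i \<bullet> y)" if y: "y \<in> x ` {1..n}" for y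
    proof -
      obtain j where j: "j \<in> {1..n}" "y = x j" using y by blast
      \<comment> \<open>The term for \<open>j\<close> equals 1, and acuteness makes the others
        nonnegative.\<close>
      have "0 < (\<Sum>i\<in>{1..n}. x i \<bullet> y)"
      proof (rule sum_pos2[of _ j])
        show "0 < x j \<bullet> y" using j x[OF j(1)] U by (auto simp: dot_square_norm)
        show "0 \<le> x i \<bullet> y" if "i \<in> {1..n}" for i using that j x acute by blast
      qed (use j in auto)
      then show ?thesis using n by (simp add: integral_uniform_count_measure)
    qed
  qed
  have eq: "sample_intrinsic_mean n x = intrinsic_mean ?P x"
    by (simp add: sample_intrinsic_mean_def intrinsic_mean_def sample_frechet_fun_eq)
  have "dual_cone (dual_cone (x ` {1..n})) \<subseteq> dual_cone (dual_cone U)"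
    by (intro dual_cone_antimono) (use x in auto)
  then show "sample_intrinsic_mean n x \<in> hsphere" "sample_intrinsic_mean n x \<in> dual_cone (dual_cone U)"
    "\<And>q. q \<in> hsphere \<Longrightarrow> sample_frechet_fun n x (sample_intrinsic_mean n x) \<le> sample_frechet_fun n x q"
    unfolding eq sample_frechet_fun_eq using S.intrinsic_mean by auto
qed

section \<open>Consistency\<close>

theorem proposition3p1:
  fixes M :: "'w measure"
    and X :: "'w \<Rightarrow> 'a::{real_inner, polish_space}"
    and Xs :: "nat \<Rightarrow> 'w \<Rightarrow> 'a"
    and U :: "'a set"
  assumes "infinite_dimensional TYPE('a)"
    and "prob_space M" and "complete_measure M"
    and "X \<in> measurable M hsphere_borel"
    and "U = rv_support M X"
    and "measure M {\<omega> \<in> space M. X \<omega> \<in> U} = 1"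
    and "(SUP (x, y)\<in>U \<times> U. geod_dist x y) \<le> pi / 2"
    and "prob_space.indep_vars M (\<lambda>_. hsphere_borel) Xs {1..}"
    and "\<And>i. i \<ge> 1 \<Longrightarrow> distr M hsphere_borel (Xs i) = distr M hsphere_borel X"
  shows "AE \<omega> in M.
    (\<lambda>n. geod_dist (sample_intrinsic_mean n (\<lambda>i. Xs i \<omega>)) (intrinsic_mean M X))
      \<longlonglongrightarrow> 0"
proof -
  interpret prob_space M by fact
  note X = assms(4) and distr = assms(9)
  have US: "U \<subseteq> hsphere" unfolding assms(5) rv_support_def by blast
  have acute: "0 \<le> x \<bullet> y" if xy: "x \<in> U" "y \<in> U" for x y
  proof -
    have in_dom: "\<bar>x \<bullet> y\<bar> \<le> 1" if "x \<in> U" "y \<in> U" for x y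
      using that US abs_inner_hsphere_le by blast
    \<comment> \<open>A real supremum bounds the members only of a set that is bounded
      above.\<close>
    have "bdd_above ((\<lambda>(x, y). geod_dist x y) ` (U \<times> U))"
      using arccos_ubound in_dom by (intro bdd_aboveI[of _ pi]) (auto simp: geod_dist_def abs_le_iff)
    then have "(\<lambda>(x, y). geod_dist x y) (x, y) \<le> (SUP (x, y)\<in>U \<times> U. geod_dist x y)"
      using xy by (intro cSUP_upper) auto
    then have "arccos (x \<bullet> y) \<le> arccos 0" using assms(7) by (simp add: geod_dist_def)
    then show ?thesis using in_dom[OF xy] arccos_le_mono[of "x \<bullet> y" 0] by simp
  qed
  \<comment> \<open>A neighbourhood of probability 0 contains no support point, so the support is
    closed and hence measurable.\<close>
  have "geod_open (hsphere - U)"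
    unfolding geod_open_def
  proof (intro conjI ballI)
    fix x assume "x \<in> hsphere - U"
    then obtain V where V: "geod_open V" "x \<in> V" "\<not> 0 < prob {\<omega> \<in> space M. X \<omega> \<in> V}"
      unfolding assms(5) rv_support_def by blast
    then have "V \<inter> U = {}" unfolding assms(5) rv_support_def by blast
    then show "\<exists>e>0. \<forall>y\<in>hsphere. geod_dist x y < e \<longrightarrow> y \<in> hsphere - U"
      using V(1,2) unfolding geod_open_def by blast
  qed blast
  then obtain T where "open T" "hsphere - U = hsphere \<inter> T"
    unfolding geod_open_iff openin_open by metis
  then have "hsphere - U \<in> sets hsphere_borel"
    unfolding sets_hsphere_borel sets_restrict_space by simp
  then have "hsphere - (hsphere - U) \<in> sets hsphere_borel"
    using sets.compl_sets[of "hsphere - U" hsphere_borel] by simp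
  then have U_sets: "U \<in> sets hsphere_borel"
    using US by (simp add: double_diff)
  then have U_pred: "{x \<in> space hsphere_borel. x \<in> U} \<in> sets hsphere_borel"
    using US by (auto simp: subset_iff intro: back_subst[of "\<lambda>S. S \<in> sets hsphere_borel"])
  \<comment> \<open>A set outside the \<sigma>-algebra has \<open>measure\<close> 0, so the value 1
    already shows measurability.\<close>
  have "{\<omega> \<in> space M. X \<omega> \<in> U} \<in> events"
    using assms(6) measure_notin_sets by fastforce
  then have AE_U: "AE \<omega> in M. X \<omega> \<in> U"
    using assms(6) prob_Collect_eq_1[of "\<lambda>\<omega>. X \<omega> \<in> U"] by simp
  have pos: "0 < expectation (\<lambda>\<omega>. X \<omega> \<bullet> x)" if x: "x \<in> U" for x
  proof -
    \<comment> \<open>This cap around the support point \<open>x\<close> has positive probability,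
      and off it acuteness keeps the inner product nonnegative, so the expectation is at least half
      that probability.\<close>
    define V where "V = hsphere \<inter> {y. y \<bullet> x > 1 / 2}"
    have "open {y. y \<bullet> x > 1 / 2}" by (intro open_Collect_less continuous_intros)
    then have V: "geod_open V" unfolding geod_open_iff V_def by (auto simp: openin_open)
    moreover have "x \<in> V" using x US by (auto simp: V_def dot_square_norm)
    ultimately have pV: "0 < prob {\<omega> \<in> space M. X \<omega> \<in> V}"
      using x unfolding assms(5) rv_support_def by blast
    have V_sets: "{\<omega> \<in> space M. X \<omega> \<in> V} \<in> events" using pV measure_notin_sets by fastforce
    have Xb: "X \<in> borel_measurable M" using X by (rule measurable_hsphere_borelD)
    have X1: "\<bar>X \<omega> \<bullet> x\<bar> \<le> 1" if "\<omega> \<in> space M" for \<omega>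
      using measurable_space[OF X that] x US by (intro abs_inner_hsphere_le) auto
    have "0 < 1 / 2 * prob {\<omega> \<in> space M. X \<omega> \<in> V}" using pV by simp
    also have "\<dots> = expectation (\<lambda>\<omega>. 1 / 2 * indicat_real {\<omega> \<in> space M. X \<omega> \<in> V} \<omega>)"
      using V_sets by simp
    also have "\<dots> \<le> expectation (\<lambda>\<omega>. X \<omega> \<bullet> x)"
    proof (rule integral_mono_AE)
      show "integrable M (\<lambda>\<omega>. X \<omega> \<bullet> x)"
        using Xb X1 by (intro integrable_const_bound[of _ 1]) auto
      show "AE \<omega> in M. 1 / 2 * indicat_real {\<omega> \<in> space M. X \<omega> \<in> V} \<omega> \<le> X \<omega> \<bullet> x"
        using AE_U by eventually_elim (auto simp: V_def indicator_def intro: acute x)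
    qed (use V_sets in \<open>simp add: emeasure_eq_measure\<close>)
    finally show ?thesis .
  qed
  interpret S: acute_sphere_rv M X U
    by unfold_locales (use X AE_U US acute pos in auto)
  define m where "m = intrinsic_mean M X"
  have m: "m \<in> hsphere" "\<And>q. q \<in> hsphere \<Longrightarrow> S.F m \<le> S.F q" "m \<in> dual_cone U"
    unfolding m_def using S.intrinsic_mean S.bidual_subset_dual by auto
  obtain b where b: "0 < b" "\<And>p. p \<in> hsphere \<Longrightarrow> p \<in> dual_cone U \<Longrightarrow> S.F p \<le> S.F m + b \<Longrightarrow>
      b * (1 - p \<bullet> m) \<le> S.F p - S.F m"
    using S.separation[OF m(1,3,2)] by metis
  have id_meas: "(\<lambda>x. x) \<in> measurable hsphere_borel (borel :: 'a measure)"
    by (rule measurable_hsphere_borelD) simp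
  have rv: "Xs i \<in> measurable M hsphere_borel" if "1 \<le> i" for i
    using assms(8) that unfolding indep_vars_def2 by auto
  \<comment> \<open>A single null set must serve all test points, because the sample mean varies
    with \<open>\<omega>\<close> and \<open>n\<close>.\<close>
  have "AE \<omega> in M. uniform_limit (clipped_sq_arccos ` cball 0 1)
      (\<lambda>n g. (\<Sum>i=1..n. g (Xs i \<omega>)) / real n) (\<lambda>g. expectation (\<lambda>w. g (X w))) sequentially"
  proof (rule uniform_strong_law)
    show "indep_vars (\<lambda>_. borel) Xs {1..}"
      using indep_vars_compose2[OF assms(8) id_meas] by simp
    have "distr M borel Y = distr (distr M hsphere_borel Y) borel (\<lambda>x. x)"
      if "Y \<in> measurable M hsphere_borel" for Y :: "'w \<Rightarrow> 'a"
      using distr_distr[OF id_meas that] by (simp add: comp_def)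
    then show "distr M borel (Xs i) = distr M borel X" if "1 \<le> i" for i
      using rv[OF that] X distr[OF that] by simp
    show "\<And>g x. g \<in> clipped_sq_arccos ` cball 0 1 \<Longrightarrow> \<bar>g x\<bar> \<le> pi\<^sup>2"
      using clipped_sq_arccos_le by auto
  qed (use clipped_sq_arccos_equicontinuous in auto)
  moreover have "AE \<omega> in M. \<forall>i\<in>{1..}. Xs i \<omega> \<in> U"
  proof (rule AE_ball_countable')
    fix i :: nat assume i: "i \<in> {1..}"
    then have "AE x in distr M hsphere_borel (Xs i). x \<in> U"
      unfolding distr[of i, simplified, OF i[simplified]]
      using AE_U by (subst AE_distr_iff[OF X U_pred])
    then show "AE \<omega> in M. Xs i \<omega> \<in> U"
      using AE_distr_iff[OF rv U_pred, of i] i by simp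
  qed simp
  ultimately show ?thesis
  proof eventually_elim
    fix \<omega>
    assume lim: "uniform_limit (clipped_sq_arccos ` cball 0 1)
      (\<lambda>n g. (\<Sum>i=1..n. g (Xs i \<omega>)) / real n) (\<lambda>g. expectation (\<lambda>w. g (X w))) sequentially"
      and XU: "\<forall>i\<in>{1..}. Xs i \<omega> \<in> U"
    define x where "x = (\<lambda>i. Xs i \<omega>)"
    define q where "q n = sample_intrinsic_mean n x" for n
    \<comment> \<open>For \<open>n = 0\<close> the sample functional is constantly 0 and its mean is
      unspecified, hence the restriction.\<close>
    have q: "q n \<in> hsphere" "q n \<in> dual_cone U"
      "\<And>r. r \<in> hsphere \<Longrightarrow> sample_frechet_fun n x (q n) \<le> sample_frechet_fun n x r" if "1 \<le> n" for n
    proof -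
      have "x i \<in> U" if "i \<in> {1..n}" for i using XU that by (auto simp: x_def)
      note sample_intrinsic_mean[OF \<open>1 \<le> n\<close> this US acute]
      then show "q n \<in> hsphere" "q n \<in> dual_cone U"
        "\<And>r. r \<in> hsphere \<Longrightarrow> sample_frechet_fun n x (q n) \<le> sample_frechet_fun n x r"
        using S.bidual_subset_dual unfolding q_def by auto
    qed
    have unif: "\<forall>\<^sub>F n in sequentially. \<forall>p\<in>hsphere. \<bar>sample_frechet_fun n x p - S.F p\<bar> < e"
      if e: "0 < e" for e
      using uniform_limitD[OF lim e]
    proof eventually_elim
      fix n
      assume *: "\<forall>g\<in>clipped_sq_arccos ` cball 0 1.
        dist ((\<Sum>i=1..n. g (Xs i \<omega>)) / real n) (expectation (\<lambda>w. g (X w))) < e"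
      show "\<forall>p\<in>hsphere. \<bar>sample_frechet_fun n x p - S.F p\<bar> < e"
      proof
        fix p :: 'a assume p: "p \<in> hsphere"
        have "(\<Sum>i=1..n. clipped_sq_arccos p (Xs i \<omega>)) = (\<Sum>i=1..n. (geod_dist (x i) p)\<^sup>2)"
        proof (rule sum.cong)
          fix i assume "i \<in> {1..n}"
          then have "x i \<in> hsphere" using XU US by (auto simp: x_def)
          then show "clipped_sq_arccos p (Xs i \<omega>) = (geod_dist (x i) p)\<^sup>2"
            unfolding geod_dist_def x_def
            by (intro clipped_sq_arccos_eq abs_inner_hsphere_le p) (simp add: x_def)
        qed simp
        moreover have "S.F p = expectation (\<lambda>w. clipped_sq_arccos p (X w))"
          using p by (intro S.F_eq_clipped) simp
        ultimately show "\<bar>sample_frechet_fun n x p - S.F p\<bar> < e"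
          using *[rule_format, of "clipped_sq_arccos p"] p
          by (simp add: sample_frechet_fun_def dist_real_def)
      qed
    qed
    have "(\<lambda>n. q n \<bullet> m) \<longlonglongrightarrow> 1"
    proof (rule tendstoI)
      fix e :: real assume e: "0 < e"
      \<comment> \<open>\<open>2 * d \<le> b\<close> brings the sample mean into the range of
        \<open>separation\<close>, and \<open>2 * d \<le> b * e\<close> makes the resulting bound at
        most \<open>e\<close>.\<close>
      define d where "d = min b (b * e) / 2"
      have d: "0 < d" using b(1) e by (simp add: d_def)
      show "\<forall>\<^sub>F n in sequentially. dist (q n \<bullet> m) 1 < e"
        using unif[OF d] eventually_ge_at_top[of 1]
      proof eventually_elim
        fix n :: nat assume u: "\<forall>p\<in>hsphere. \<bar>sample_frechet_fun n x p - S.F p\<bar> < d" and n: "1 \<le> n"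
        note qn = q[OF n]
        \<comment> \<open>Uniform closeness costs \<open>d\<close> at \<open>q n\<close> and
          \<open>d\<close> at \<open>m\<close>, with minimality of \<open>q n\<close> for the sample
          functional in between.\<close>
        have "S.F (q n) < S.F m + 2 * d"
          using u[rule_format, OF qn(1)] u[rule_format, OF m(1)] qn(3)[OF m(1)] by linarith
        moreover from this have "b * (1 - q n \<bullet> m) \<le> S.F (q n) - S.F m"
          by (intro b(2) qn) (simp add: d_def)
        ultimately have "b * (1 - q n \<bullet> m) < b * e" by (simp add: d_def)
        then have "1 - q n \<bullet> m < e" using b(1) by simp
        then show "dist (q n \<bullet> m) 1 < e"
          using abs_inner_hsphere_le[OF qn(1) m(1)] by (simp add: dist_real_def)
      qed
    qed
    moreover have "\<forall>\<^sub>F n in sequentially. q n \<bullet> m \<in> {-1..1}"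
      using eventually_ge_at_top[of 1]
      by eventually_elim (use abs_inner_hsphere_le[OF q(1) m(1)] in \<open>simp add: abs_le_iff\<close>)
    ultimately have "(\<lambda>n. arccos (q n \<bullet> m)) \<longlonglongrightarrow> arccos 1"
      by (intro continuous_on_tendsto_compose[OF continuous_on_arccos']) auto
    then show "(\<lambda>n. geod_dist (sample_intrinsic_mean n (\<lambda>i. Xs i \<omega>)) (intrinsic_mean M X)) \<longlonglongrightarrow> 0"
      by (simp add: geod_dist_def q_def x_def m_def)
  qed
qed

end
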